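(* Let $G$ be an infinite group which is either (i) a virtually soluble group, or (ii) a virtually free group, and let $\omega$ be an arbitrary weight on $G$. Then $\ell^1(G,\omega)$ contains a maximal left ideal of finite codimension which is not finitely generated. In particular, $\ell^1(G,\omega)$ satisfies the Dales--\.Zelazko conjecture, i.e. it has a maximal left ideal which is not finitely generated.
   Context: Groups are discrete. A weight on a group $G$ is a function $\omega\colon G\to[1,\infty)$ with $\omega(st)\le\omega(s)\omega(t)$ for all $s,t\in G$ and $\omega(e)=1$. The Beurling algebra is $\ell^1(G,\omega)=\{f\colon G\to\mathbb{C} : \sum_{t\in G}|f(t)|\omega(t)<\infty\}$, a unital Banach algebra under convolution with norm $\|f\|_\omega=\sum_{t\in G}|f(t)|\omega(t)$. A left ideal $I$ of a unital Banach algebra $A$ is finitely generated if there are $n\in\mathbb{N}$ and $a_1,\dots,a_n\in I$ with $I=Aa_1+\cdots+Aa_n$ (algebraically; no closure is taken). A group is virtually soluble (respectively virtually free) if it has a finite-index subgroup that is soluble (respectively free). The Dales--\.Zelazko conjecture asserts that every infinite-dimensional unital Banach algebra has a maximal left ideal which is not finitely generated. *)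

theory Defs
  imports "HOL-Analysis.Infinite_Sum" "HOL-Algebra.Algebra"
begin

subsection \<open>Finite-index subgroups, free groups\<close>

definition finite_index_subgroup :: "'a set \<Rightarrow> ('a, 'm) monoid_scheme \<Rightarrow> bool"
  where "finite_index_subgroup H G \<longleftrightarrow> subgroup H G \<and> finite (rcosets\<^bsub>G\<^esub> H)"

text \<open>A word is a list of signed letters: \<open>(s, True)\<close> stands for \<open>s\<close> and
  \<open>(s, False)\<close> for the inverse of \<open>s\<close>.\<close>

definition reduced_words :: "'a set \<Rightarrow> ('a \<times> bool) list set"
  where "reduced_words S =
    {w \<in> lists (S \<times> UNIV). successively (\<lambda>(s, b) (t, c). \<not> (s = t \<and> b \<noteq> c)) w}"

definition eval_word :: "('a, 'm) monoid_scheme \<Rightarrow> ('a \<times> bool) list \<Rightarrow> 'a"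
  where "eval_word G w =
    foldr (\<lambda>(s, b) x. (if b then s else inv\<^bsub>G\<^esub> s) \<otimes>\<^bsub>G\<^esub> x) w \<one>\<^bsub>G\<^esub>"

text \<open>\<open>G\<close> is free on \<open>S\<close> if every element is represented by exactly one reduced word
  in \<open>S\<close> and its inverses. The rank may be infinite, or zero (the trivial group).\<close>

definition free_group :: "('a, 'm) monoid_scheme \<Rightarrow> bool"
  where "free_group G \<longleftrightarrow> group G \<and>
    (\<exists>S \<subseteq> carrier G. bij_betw (eval_word G) (reduced_words S) (carrier G))"

definition virtually_soluble :: "('a, 'm) monoid_scheme \<Rightarrow> bool"
  where "virtually_soluble G \<longleftrightarrow>
    (\<exists>H. finite_index_subgroup H G \<and> solvable (G\<lparr>carrier := H\<rparr>))"

definition virtually_free :: "('a, 'm) monoid_scheme \<Rightarrow> bool"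
  where "virtually_free G \<longleftrightarrow>
    (\<exists>H. finite_index_subgroup H G \<and> free_group (G\<lparr>carrier := H\<rparr>))"


subsection \<open>Weights and Beurling algebras\<close>

definition weight :: "('a, 'm) monoid_scheme \<Rightarrow> ('a \<Rightarrow> real) \<Rightarrow> bool"
  where "weight G \<omega> \<longleftrightarrow>
    (\<forall>s \<in> carrier G. 1 \<le> \<omega> s) \<and>
    (\<forall>s \<in> carrier G. \<forall>t \<in> carrier G. \<omega> (s \<otimes>\<^bsub>G\<^esub> t) \<le> \<omega> s * \<omega> t) \<and>
    \<omega> \<one>\<^bsub>G\<^esub> = 1"

text \<open>Functions on \<open>carrier G\<close> are represented by functions on the whole type that
  vanish off \<open>carrier G\<close>. The series defining the convolution converge absolutely for
  all elements of the carrier, as weights are at least 1.\<close>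

definition beurling_algebra ::
    "('a, 'm) monoid_scheme \<Rightarrow> ('a \<Rightarrow> real) \<Rightarrow> (complex, 'a \<Rightarrow> complex) module"
  where "beurling_algebra G \<omega> =
    \<lparr>carrier = {f. (\<forall>t. t \<notin> carrier G \<longrightarrow> f t = 0) \<and>
                   (\<lambda>t. cmod (f t) * \<omega> t) summable_on carrier G},
     monoid.mult = (\<lambda>f g t. if t \<in> carrier G
                     then \<Sum>\<^sub>\<infinity>s\<in>carrier G. f s * g (inv\<^bsub>G\<^esub> s \<otimes>\<^bsub>G\<^esub> t) else 0),
     monoid.one = (\<lambda>t. if t = \<one>\<^bsub>G\<^esub> then 1 else 0),
     ring.zero = (\<lambda>t. 0),
     ring.add = (\<lambda>f g t. f t + g t),
     module.smult = (\<lambda>c f t. c * f t)\<rparr>"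


subsection \<open>Left ideals\<close>

locale left_ideal = additive_subgroup I R + ring R for I and R (structure) +
  assumes I_l_closed: "\<lbrakk>a \<in> I; x \<in> carrier R\<rbrakk> \<Longrightarrow> x \<otimes> a \<in> I"

locale maximal_left_ideal = left_ideal +
  assumes I_notcarrier: "carrier R \<noteq> I"
    and I_maximal: "\<lbrakk>left_ideal J R; I \<subseteq> J; J \<subseteq> carrier R\<rbrakk> \<Longrightarrow> J = I \<or> J = carrier R"

definition finitely_generated_left_ideal :: "'a set \<Rightarrow> ('a, 'm) ring_scheme \<Rightarrow> bool"
  where "finitely_generated_left_ideal I R \<longleftrightarrow>
    left_ideal I R \<and>
    (\<exists>(n::nat) a. (\<forall>k<n. a k \<in> I) \<and>
      I = {\<Oplus>\<^bsub>R\<^esub>k\<in>{..<n}. x k \<otimes>\<^bsub>R\<^esub> a k | x. \<forall>k<n. x k \<in> carrier R})"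

text \<open>The complex vector space \<open>A / I\<close> is finite-dimensional: it is spanned by the
  cosets of finitely many elements of \<open>A\<close>. A left ideal of a unital algebra is
  automatically a complex subspace.\<close>

definition finite_codimension :: "'a set \<Rightarrow> (complex, 'a, 'm) module_scheme \<Rightarrow> bool"
  where "finite_codimension I A \<longleftrightarrow>
    (\<exists>F. finite F \<and> F \<subseteq> carrier A \<and>
      (\<forall>a \<in> carrier A. \<exists>c. \<exists>i \<in> I. a = i \<oplus>\<^bsub>A\<^esub> (\<Oplus>\<^bsub>A\<^esub>f\<in>F. c f \<odot>\<^bsub>A\<^esub> f)))"

end

theory Submission
  imports Defs
begin

text \<open>Let \<open>A = \<ell>\<^sup>1(G, \<omega>)\<close>. Two independent ideas carry the proof.

\<^bold>\<open>It is enough to find a left ideal of finite codimension that is not finitely generated.\<close>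
Take such an ideal \<open>J\<close> of least codimension, a minimal left ideal \<open>K\<close> strictly above it, and \<open>k\<close> in
\<open>K - J\<close>. Since \<open>K / J\<close> is a simple module generated by \<open>k\<close>, the ideal \<open>M = {a. a k \<in> J}\<close> is maximal,
and \<open>A / M\<close> embeds in \<open>A / J\<close>. By minimality \<open>K\<close> is finitely generated, so finitely many generators of \<open>M\<close>
would yield finitely many generators of \<open>J\<close>. This is \<open>non_finitely_generated_maximal_left_ideal\<close>.

\<^bold>\<open>Such an ideal is induced from a positive character.\<close>
Let \<open>H\<close> be a subgroup of finite index and \<open>\<chi>\<close> a homomorphism from \<open>H\<close> to the positive reals with \<open>\<chi> \<le> \<omega>\<close>.
Then \<open>\<chi>\<close> is a bounded character of \<open>\<ell>\<^sup>1(H, \<omega>)\<close>, and its kernel generates a left ideal \<open>J\<close> of \<open>A\<close> whose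
codimension is the index of \<open>H\<close>. The twisted weight \<open>w = \<omega> / \<chi>\<close> on \<open>H\<close> is again submultiplicative and at
least 1, and \<open>exponential_growth_if_finitely_generated_J\<close> shows: if \<open>J\<close> is finitely generated, then \<open>H\<close> is
generated by a finite set \<open>L\<close> and \<open>w\<close> grows exponentially in the word length over \<open>L\<close>.

The proof of this fact tests elements of \<open>J\<close> against functionals \<open>f \<mapsto> \<Sum>h\<in>H. f h * \<chi> h * v h\<close>. They
are bounded, uniformly in the function \<open>v\<close>, on the left ideal generated by \<open>a\<^sub>1, \<dots>, a\<^sub>n\<close>, as soon as
\<open>|v (h l) - v h| \<le> w h * w l * \<eta> l\<close> for \<open>l\<close> in the supports of the \<open>a\<^sub>i\<close>; here \<open>\<eta> \<ge> 1\<close> tends to infinity so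
slowly that the \<open>a\<^sub>i\<close> remain summable with the additional factor \<open>\<eta>\<close>. The best choice of \<open>v\<close> is the distance to
the identity in the graph whose edges \<open>h - h l\<close> have these lengths. Elements of \<open>J\<close> concentrated far from the
identity then force \<open>v \<le> C * w\<close>. Hence a nearly shortest path to \<open>h\<close>, whose length is at most about
\<open>C * w h\<close>, ends with an edge of length at least \<open>w h * \<eta> l\<close>: so \<open>\<eta> l\<close> is bounded, which leaves finitely many
\<open>l\<close>, and the last edge takes at least a fixed proportion of the whole path. Lengths therefore grow geometrically along
the path.

It remains to choose \<open>H\<close> and \<open>\<chi>\<close> so that the conclusion fails. If \<open>H\<close> is not finitely generated, \<open>\<chi> = 1\<close>
does. If there is a nonzero additive \<open>\<phi> : H \<rightarrow> \<real>\<close>, let \<open>\<chi> = exp (c * \<phi>)\<close> where \<open>c\<close> is the infimum of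
\<open>ln (\<omega> h) / \<phi> h\<close> over all \<open>h\<close> with \<open>\<phi> h > 0\<close>. For \<open>\<epsilon> > 0\<close> some such \<open>h\<close> satisfies
\<open>w (h ^ k) \<le> exp (\<epsilon> * \<phi> (h ^ k))\<close> for all \<open>k\<close>, while \<open>\<phi>\<close> is bounded by a multiple of the word length; so
the growth is not exponential. In a free group the exponent sum of a letter is such a \<open>\<phi>\<close>. In a virtually
soluble group some \<open>K\<close> in a derived series has finite index while its commutator subgroup has not. If \<open>K\<close> is
finitely generated, adjoin its generators to the commutator subgroup one at a time: the step at which the index
becomes finite exhibits a subgroup of finite index that maps onto an infinite cyclic group.\<close>

section \<open>Left ideals and their generators\<close>

lemma (in ring) left_idealI:
  assumes "I \<subseteq> carrier R" "\<zero> \<in> I"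
    and "\<And>a b. a \<in> I \<Longrightarrow> b \<in> I \<Longrightarrow> a \<oplus> b \<in> I"
    and "\<And>a x. a \<in> I \<Longrightarrow> x \<in> carrier R \<Longrightarrow> x \<otimes> a \<in> I"
  shows "left_ideal I R"
proof -
  have "\<ominus> a \<in> I" if "a \<in> I" for a
  proof -
    have "(\<ominus> \<one>) \<otimes> a \<in> I" using that assms(4) by simp
    moreover have "a \<in> carrier R" using that assms(1) by blast
    ultimately show ?thesis by (simp add: l_minus)
  qed
  then have "subgroup I (add_monoid R)"
    using assms by (auto intro!: add.subgroupI simp flip: a_inv_def)
  then show ?thesis
    by (intro left_ideal.intro additive_subgroup.intro left_ideal_axioms.intro ring_axioms) (use assms in auto)
qed

lemma left_idealD:
  assumes "left_ideal I R"
  shows "I \<subseteq> carrier R" "\<zero>\<^bsub>R\<^esub> \<in> I" "\<And>a b. a \<in> I \<Longrightarrow> b \<in> I \<Longrightarrow> a \<oplus>\<^bsub>R\<^esub> b \<in> I"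
    "\<And>a x. a \<in> I \<Longrightarrow> x \<in> carrier R \<Longrightarrow> x \<otimes>\<^bsub>R\<^esub> a \<in> I" "\<And>a. a \<in> I \<Longrightarrow> \<ominus>\<^bsub>R\<^esub> a \<in> I"
proof -
  interpret left_ideal I R by fact
  show "I \<subseteq> carrier R" by (rule a_subset)
  show "\<zero>\<^bsub>R\<^esub> \<in> I" by simp
  show "\<And>a b. a \<in> I \<Longrightarrow> b \<in> I \<Longrightarrow> a \<oplus>\<^bsub>R\<^esub> b \<in> I" by simp
  show "\<And>a x. a \<in> I \<Longrightarrow> x \<in> carrier R \<Longrightarrow> x \<otimes>\<^bsub>R\<^esub> a \<in> I" by (rule I_l_closed)
  show "\<ominus>\<^bsub>R\<^esub> a \<in> I" if "a \<in> I" for a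
  proof -
    have "(\<ominus>\<^bsub>R\<^esub> \<one>\<^bsub>R\<^esub>) \<otimes>\<^bsub>R\<^esub> a \<in> I" using that by (intro I_l_closed) auto
    then show ?thesis using that a_subset by (auto simp: l_minus)
  qed
qed

context ring begin

lemma left_ideal_carrier: "left_ideal (carrier R) R"
  by (rule left_idealI) auto

lemma left_ideal_minus: "left_ideal I R \<Longrightarrow> a \<in> I \<Longrightarrow> b \<in> I \<Longrightarrow> a \<ominus> b \<in> I"
  by (simp add: a_minus_def left_idealD)

lemma left_ideal_inter: "left_ideal I R \<Longrightarrow> left_ideal K R \<Longrightarrow> left_ideal (I \<inter> K) R"
  by (rule left_idealI) (auto dest: left_idealD)

lemma left_ideal_quotient:
  assumes I: "left_ideal I R" and k: "k \<in> carrier R"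
  shows "left_ideal {a \<in> carrier R. a \<otimes> k \<in> I} R"
proof (rule left_idealI, goal_cases)
  case 2 show ?case using k left_idealD(2)[OF I] by simp
next
  case (3 a b) then show ?case using k left_idealD(3)[OF I] by (simp add: l_distr)
next
  case (4 a x) then show ?case using k left_idealD(4)[OF I] by (simp add: m_assoc)
qed auto

definition adjoin :: "'a set \<Rightarrow> 'a \<Rightarrow> 'a set" where
  "adjoin I k = {a \<otimes> k \<oplus> i | a i. a \<in> carrier R \<and> i \<in> I}"

lemma left_ideal_adjoin:
  assumes I: "left_ideal I R" and k: "k \<in> carrier R"
  shows "left_ideal (adjoin I k) R"
proof (rule left_idealI, goal_cases)
  case 1 show ?case using k left_idealD(1)[OF I] by (auto simp: adjoin_def)
next
  case 2
  have "\<zero> = \<zero> \<otimes> k \<oplus> \<zero>" using k by simp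
  then show ?case unfolding adjoin_def using left_idealD(2)[OF I] by blast
next
  case (3 x y)
  then obtain a i b j where *: "x = a \<otimes> k \<oplus> i" "y = b \<otimes> k \<oplus> j" "a \<in> carrier R" "b \<in> carrier R"
    "i \<in> I" "j \<in> I" unfolding adjoin_def by blast
  moreover have "i \<in> carrier R" "j \<in> carrier R" using * left_idealD(1)[OF I] by blast+
  ultimately have "x \<oplus> y = (a \<oplus> b) \<otimes> k \<oplus> (i \<oplus> j)" using k by (simp add: l_distr a_ac)
  then show ?case unfolding adjoin_def using * left_idealD(3)[OF I] by blast
next
  case (4 x y)
  then obtain a i where *: "x = a \<otimes> k \<oplus> i" "a \<in> carrier R" "i \<in> I" unfolding adjoin_def by blast
  moreover have "i \<in> carrier R" using * left_idealD(1)[OF I] by blast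
  ultimately have "y \<otimes> x = (y \<otimes> a) \<otimes> k \<oplus> (y \<otimes> i)" using k 4 by (simp add: r_distr m_assoc)
  then show ?case unfolding adjoin_def using * 4 left_idealD(4)[OF I] by blast
qed

lemma adjoin_subset:
  assumes I: "left_ideal I R" and k: "k \<in> carrier R"
  shows "I \<subseteq> adjoin I k" "k \<in> adjoin I k"
proof -
  have "i = \<zero> \<otimes> k \<oplus> i" if "i \<in> I" for i using k left_idealD(1)[OF I] that by auto
  then show "I \<subseteq> adjoin I k" unfolding adjoin_def by blast
  have "k = \<one> \<otimes> k \<oplus> \<zero>" using k by simp
  then show "k \<in> adjoin I k" unfolding adjoin_def using left_idealD(2)[OF I] by blast
qed

lemma adjoin_minimal:
  assumes "left_ideal K R" "I \<subseteq> K" "k \<in> K"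
  shows "adjoin I k \<subseteq> K"
  using left_idealD(3,4)[OF assms(1)] assms(2,3) by (auto simp: adjoin_def)

lemma left_ideal_combinations:
  fixes n :: nat
  assumes a: "\<And>k. k < n \<Longrightarrow> a k \<in> carrier R"
  shows "left_ideal {\<Oplus>k\<in>{..<n}. x k \<otimes> a k | x. \<forall>k<n. x k \<in> carrier R} R" (is "left_ideal ?K R")
    and "\<And>k. k < n \<Longrightarrow> a k \<in> {\<Oplus>k\<in>{..<n}. x k \<otimes> a k | x. \<forall>k<n. x k \<in> carrier R}"
proof -
  show "left_ideal ?K R"
  proof (rule left_idealI, goal_cases)
    case 1 show ?case using a by (auto intro!: finsum_closed)
  next
    case 2
    have "(\<Oplus>k\<in>{..<n}. \<zero> \<otimes> a k) = (\<Oplus>k\<in>{..<n}. \<zero>)"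
      by (rule finsum_cong') (use a in auto)
    also have "\<dots> = \<zero>" by (rule finsum_zero)
    finally have "\<zero> = (\<Oplus>k\<in>{..<n}. \<zero> \<otimes> a k)" by simp
    then show ?case by (auto intro!: exI[of _ "\<lambda>_. \<zero>"])
  next
    case (3 p q)
    then obtain x y where *: "p = (\<Oplus>k\<in>{..<n}. x k \<otimes> a k)" "\<forall>k<n. x k \<in> carrier R"
      "q = (\<Oplus>k\<in>{..<n}. y k \<otimes> a k)" "\<forall>k<n. y k \<in> carrier R" by blast
    have "p \<oplus> q = (\<Oplus>k\<in>{..<n}. x k \<otimes> a k \<oplus> y k \<otimes> a k)"
      unfolding *(1,3) by (rule finsum_addf[symmetric]) (use a * in auto)
    also have "\<dots> = (\<Oplus>k\<in>{..<n}. (x k \<oplus> y k) \<otimes> a k)"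
      by (rule finsum_cong') (use a * in \<open>auto simp: l_distr\<close>)
    finally show ?case using * by (auto intro!: exI[of _ "\<lambda>k. x k \<oplus> y k"])
  next
    case (4 p y)
    then obtain x where *: "p = (\<Oplus>k\<in>{..<n}. x k \<otimes> a k)" "\<forall>k<n. x k \<in> carrier R" by blast
    have "y \<otimes> p = (\<Oplus>k\<in>{..<n}. y \<otimes> (x k \<otimes> a k))"
      unfolding * by (rule finsum_rdistr) (use 4 a * in auto)
    also have "\<dots> = (\<Oplus>k\<in>{..<n}. (y \<otimes> x k) \<otimes> a k)"
      by (rule finsum_cong') (use 4 a * in \<open>auto simp: m_assoc\<close>)
    finally show ?case using 4 * by (auto intro!: exI[of _ "\<lambda>k. y \<otimes> x k"])
  qed
  fix j assume j: "j < n"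
  have "(\<Oplus>k\<in>{..<n}. (if k = j then \<one> else \<zero>) \<otimes> a k) = (\<Oplus>k\<in>{..<n}. if j = k then a k else \<zero>)"
    by (rule finsum_cong') (use a in auto)
  also have "\<dots> = a j"
    by (rule finsum_singleton) (use a j in auto)
  finally show "a j \<in> ?K"
    by (auto intro!: exI[of _ "\<lambda>k. if k = j then \<one> else \<zero>"])
qed

text \<open>Finite generation as a minimality property, which makes no reference to numberings of the generators. All later
arguments about generators proceed by exhibiting a suitable left ideal that contains them.\<close>
lemma finitely_generated_left_ideal_iff:
  "finitely_generated_left_ideal I R \<longleftrightarrow> left_ideal I R \<and>
    (\<exists>S. finite S \<and> S \<subseteq> I \<and> (\<forall>K. left_ideal K R \<longrightarrow> S \<subseteq> K \<longrightarrow> I \<subseteq> K))" (is "?L \<longleftrightarrow> ?R")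
proof
  assume ?L
  then obtain n :: nat and a where I: "left_ideal I R" and a: "\<forall>k<n. a k \<in> I"
    and gen: "I = {\<Oplus>k\<in>{..<n}. x k \<otimes> a k | x. \<forall>k<n. x k \<in> carrier R}"
    unfolding finitely_generated_left_ideal_def by blast
  have "I \<subseteq> K" if K: "left_ideal K R" "a ` {..<n} \<subseteq> K" for K
  proof
    fix p assume "p \<in> I"
    then obtain x where x: "p = (\<Oplus>k\<in>{..<n}. x k \<otimes> a k)" "\<forall>k<n. x k \<in> carrier R" using gen by blast
    have "finite F \<Longrightarrow> F \<subseteq> {..<n} \<Longrightarrow> (\<Oplus>k\<in>F. x k \<otimes> a k) \<in> K" for F
    proof (induction rule: finite_induct)
      case empty show ?case using left_idealD(2)[OF K(1)] by simp
    next
      case (insert k F)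
      have "x j \<otimes> a j \<in> K" if "j < n" for j using left_idealD(4)[OF K(1)] x(2) K(2) that by blast
      moreover have "x j \<otimes> a j \<in> carrier R" if "j < n" for j
        using that calculation left_idealD(1)[OF K(1)] by blast
      ultimately have "(\<Oplus>k\<in>insert k F. x k \<otimes> a k) = x k \<otimes> a k \<oplus> (\<Oplus>k\<in>F. x k \<otimes> a k)"
        using insert by (subst finsum_insert) (auto simp: subset_iff)
      then show ?case using insert left_idealD(3)[OF K(1)] \<open>\<And>j. j < n \<Longrightarrow> x j \<otimes> a j \<in> K\<close> by simp
    qed
    then show "p \<in> K" using x by simp
  qed
  then show ?R using I a by (intro conjI exI[of _ "a ` {..<n}"]) auto
next
  assume ?R
  then obtain S where I: "left_ideal I R" and S: "finite S" "S \<subseteq> I"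
    and min: "\<And>K. left_ideal K R \<Longrightarrow> S \<subseteq> K \<Longrightarrow> I \<subseteq> K" by blast
  obtain a and n :: nat where an: "S = a ` {i. i < n}"
    using S(1) finite_imp_nat_seg_image_inj_on by blast
  have aI: "\<forall>k<n. a k \<in> I" using an S(2) by blast
  have ac: "\<And>k. k < n \<Longrightarrow> a k \<in> carrier R" using aI left_idealD(1)[OF I] by blast
  let ?K = "{\<Oplus>k\<in>{..<n}. x k \<otimes> a k | x. \<forall>k<n. x k \<in> carrier R}"
  have "I \<subseteq> ?K"
    by (rule min) (use left_ideal_combinations[of n a, OF ac] an in auto)
  moreover have "?K \<subseteq> I"
  proof
    fix p assume "p \<in> ?K"
    then obtain x where x: "p = (\<Oplus>k\<in>{..<n}. x k \<otimes> a k)" "\<forall>k<n. x k \<in> carrier R" by blast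
    have "finite F \<Longrightarrow> F \<subseteq> {..<n} \<Longrightarrow> (\<Oplus>k\<in>F. x k \<otimes> a k) \<in> I" for F
    proof (induction rule: finite_induct)
      case empty show ?case using left_idealD(2)[OF I] by simp
    next
      case (insert k F)
      have "(\<Oplus>k\<in>insert k F. x k \<otimes> a k) = x k \<otimes> a k \<oplus> (\<Oplus>k\<in>F. x k \<otimes> a k)"
        using insert x ac by (subst finsum_insert) (auto simp: subset_iff)
      then show ?case using insert left_idealD(3,4)[OF I] x aI by simp
    qed
    then show "p \<in> I" using x by simp
  qed
  ultimately show ?L unfolding finitely_generated_left_ideal_def using I aI by blast
qed

end

section \<open>Left ideals of finite codimension\<close>

locale complex_algebra = ring A for A :: "(complex, 'b, 'm) module_scheme" (structure) +
  assumes smult_closed [simp, intro]: "x \<in> carrier A \<Longrightarrow> c \<odot> x \<in> carrier A"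
    and smult_l_distr: "x \<in> carrier A \<Longrightarrow> (c + d) \<odot> x = c \<odot> x \<oplus> d \<odot> x"
    and smult_r_distr: "x \<in> carrier A \<Longrightarrow> y \<in> carrier A \<Longrightarrow> c \<odot> (x \<oplus> y) = c \<odot> x \<oplus> c \<odot> y"
    and smult_assoc1: "x \<in> carrier A \<Longrightarrow> (c * d) \<odot> x = c \<odot> (d \<odot> x)"
    and smult_one [simp]: "x \<in> carrier A \<Longrightarrow> 1 \<odot> x = x"
    and smult_assoc2: "x \<in> carrier A \<Longrightarrow> y \<in> carrier A \<Longrightarrow> (c \<odot> x) \<otimes> y = c \<odot> (x \<otimes> y)"
begin

lemma smult_zero [simp]: "x \<in> carrier A \<Longrightarrow> 0 \<odot> x = \<zero>"
proof -
  assume x: "x \<in> carrier A"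
  have "0 \<odot> x \<oplus> 0 \<odot> x = 0 \<odot> x \<oplus> \<zero>" using smult_l_distr[OF x, of 0 0] x by simp
  then show ?thesis using x by (subst (asm) add.l_cancel) auto
qed

lemma smult_minus: "x \<in> carrier A \<Longrightarrow> (- c) \<odot> x = \<ominus> (c \<odot> x)"
  using smult_l_distr[of x c "- c"] by (auto intro!: minus_equality[symmetric] simp: a_comm)

lemma left_ideal_smult:
  assumes "left_ideal I A" "x \<in> I"
  shows "c \<odot> x \<in> I"
proof -
  have x: "x \<in> carrier A" using assms left_idealD(1) by blast
  then have "(c \<odot> \<one>) \<otimes> x = c \<odot> x" by (simp add: smult_assoc2)
  moreover have "(c \<odot> \<one>) \<otimes> x \<in> I" using assms by (intro left_idealD(4)) auto
  ultimately show ?thesis by simp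
qed

definition comb :: "('b \<Rightarrow> complex) \<Rightarrow> 'b set \<Rightarrow> 'b" where
  "comb c F = (\<Oplus>f\<in>F. c f \<odot> f)"

definition spans_mod :: "'b set \<Rightarrow> 'b set \<Rightarrow> bool" where
  "spans_mod V F \<longleftrightarrow> finite F \<and> F \<subseteq> carrier A \<and> (\<forall>a\<in>carrier A. \<exists>c. \<exists>i\<in>V. a = i \<oplus> comb c F)"

lemma finite_codimension_iff: "finite_codimension V A \<longleftrightarrow> (\<exists>F. spans_mod V F)"
  unfolding finite_codimension_def spans_mod_def comb_def by auto

lemma comb_closed [simp]: "F \<subseteq> carrier A \<Longrightarrow> comb c F \<in> carrier A"
  unfolding comb_def by (intro finsum_closed) auto

lemma comb_insert:
  assumes "finite F" "F \<subseteq> carrier A" "f \<in> carrier A" "f \<notin> F"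
  shows "comb c (insert f F) = c f \<odot> f \<oplus> comb c F"
  unfolding comb_def using assms by (subst finsum_insert) auto

lemma comb_cong: "(\<And>f. f \<in> F \<Longrightarrow> c f = d f) \<Longrightarrow> F \<subseteq> carrier A \<Longrightarrow> comb c F = comb d F"
  unfolding comb_def by (intro finsum_cong') auto

lemma comb_add:
  assumes "finite F" "F \<subseteq> carrier A"
  shows "comb c F \<oplus> comb d F = comb (\<lambda>f. c f + d f) F"
  using assms
proof (induction rule: finite_induct)
  case empty then show ?case by (simp add: comb_def)
next
  case (insert f F)
  then show ?case by (simp add: comb_insert smult_l_distr a_ac flip: insert.IH)
qed

lemma comb_smult:
  assumes "finite F" "F \<subseteq> carrier A"
  shows "z \<odot> comb c F = comb (\<lambda>f. z * c f) F"
  using assms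
proof (induction rule: finite_induct)
  case empty
  have "z \<odot> \<zero> = (z * 0) \<odot> \<zero>" by (subst smult_assoc1) auto
  then show ?case by (simp add: comb_def)
next
  case (insert f F)
  then show ?case by (simp add: comb_insert smult_r_distr smult_assoc1 flip: insert.IH)
qed

text \<open>The hypothesis on \<open>W\<close> says that \<open>W\<close> lies in the sum of \<open>V\<close> and the line through \<open>y\<close>, so one more vector makes
up for the passage from \<open>W\<close> down to \<open>V\<close>.\<close>
lemma spans_mod_insert:
  assumes F: "spans_mod W F" and y: "y \<in> carrier A" and V: "V \<subseteq> carrier A"
    and W: "\<And>w. w \<in> W \<Longrightarrow> \<exists>v\<in>V. \<exists>c. w = v \<oplus> c \<odot> y"
  shows "spans_mod V (insert y F)"
proof -
  have fin: "finite F" "F \<subseteq> carrier A" using F by (auto simp: spans_mod_def)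
  have "\<exists>c. \<exists>i\<in>V. a = i \<oplus> comb c (insert y F)" if a: "a \<in> carrier A" for a
  proof -
    obtain c w where w: "w \<in> W" "a = w \<oplus> comb c F" using F a by (auto simp: spans_mod_def)
    obtain v z where v: "v \<in> V" "w = v \<oplus> z \<odot> y" using W w(1) by blast
    have vc: "v \<in> carrier A" using v V by auto
    show ?thesis
    proof (cases "y \<in> F")
      case True
      define F' where "F' = F - {y}"
      have F': "F = insert y F'" "y \<notin> F'" "finite F'" "F' \<subseteq> carrier A" using True fin by (auto simp: F'_def)
      have "comb (c(y := c y + z)) F = (c y + z) \<odot> y \<oplus> comb c F'"
        unfolding F'(1) using F' y by (subst comb_insert) (auto intro!: arg_cong2[of _ _ _ _ "(\<oplus>)"] comb_cong)
      moreover have "comb c F = c y \<odot> y \<oplus> comb c F'"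
        unfolding F'(1) using F' y by (subst comb_insert) auto
      ultimately have "a = v \<oplus> comb (c(y := c y + z)) F"
        using w v vc y F' by (simp add: smult_l_distr a_ac)
      moreover have "insert y F = F" using True by auto
      ultimately show ?thesis using v(1) by metis
    next
      case False
      have "comb (c(y := z)) (insert y F) = z \<odot> y \<oplus> comb c F"
        using False fin y by (subst comb_insert) (auto intro!: arg_cong2[of _ _ _ _ "(\<oplus>)"] comb_cong)
      then have "a = v \<oplus> comb (c(y := z)) (insert y F)"
        using w v vc y fin by (simp add: a_ac)
      then show ?thesis using v(1) by metis
    qed
  qed
  then show ?thesis using fin y by (simp add: spans_mod_def)
qed

text \<open>Exchange argument: write a vector of \<open>W - V\<close> in terms of \<open>F\<close> modulo \<open>V\<close>; a vector \<open>f\<close> that occurs in it with a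
nonzero coefficient is redundant modulo \<open>W\<close>. Codimension thus drops strictly along proper inclusions, which
provides maximal and minimal left ideals.\<close>
lemma spans_mod_drop:
  assumes V: "left_ideal V A" and W: "left_ideal W A" and VW: "V \<subset> W" and F: "spans_mod V F"
  shows "\<exists>f\<in>F. spans_mod W (F - {f})"
proof -
  have fin: "finite F" "F \<subseteq> carrier A" using F by (auto simp: spans_mod_def)
  obtain y where y: "y \<in> W" "y \<notin> V" using VW by blast
  have yc: "y \<in> carrier A" using y left_idealD(1)[OF W] by blast
  obtain i c where i: "i \<in> V" "y = i \<oplus> comb c F" using F yc by (auto simp: spans_mod_def)
  have ic: "i \<in> carrier A" using i left_idealD(1)[OF V] by blast
  have "(i \<oplus> x) \<ominus> i = x" if "x \<in> carrier A" for x
    using ic that by (simp add: a_minus_def a_comm[of i x] a_assoc r_neg)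
  then have yi: "comb c F = y \<ominus> i" using i(2) comb_closed[OF fin(2)] by metis
  have "\<exists>f\<in>F. c f \<noteq> 0"
  proof (rule ccontr)
    assume "\<not> (\<exists>f\<in>F. c f \<noteq> 0)"
    then have "comb c F = (\<Oplus>f\<in>F. \<zero>)" unfolding comb_def using fin by (intro finsum_cong') auto
    then have "y = i" using i ic by simp
    then show False using y i by simp
  qed
  then obtain f where f: "f \<in> F" "c f \<noteq> 0" by blast
  define F' where "F' = F - {f}"
  have F': "F = insert f F'" "f \<notin> F'" "finite F'" "F' \<subseteq> carrier A" "f \<in> carrier A"
    using f fin by (auto simp: F'_def)
  have "\<exists>d. \<exists>w\<in>W. a = w \<oplus> comb d F'" if a: "a \<in> carrier A" for a
  proof -
    obtain j d where j: "j \<in> V" "a = j \<oplus> comb d F" using F a by (auto simp: spans_mod_def)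
    have jc: "j \<in> carrier A" using j left_idealD(1)[OF V] by blast
    define z where "z = d f / c f"
    let ?r = "\<lambda>g. d g - z * c g"
    have "comb (\<lambda>g. z * c g) F \<oplus> comb ?r F = comb d F"
      using fin by (subst comb_add) auto
    moreover have "comb ?r F = comb ?r F'"
      unfolding F'(1) using F' f(2) by (subst comb_insert) (auto simp: z_def)
    moreover have "comb (\<lambda>g. z * c g) F = z \<odot> (y \<ominus> i)"
      unfolding yi[symmetric] by (rule comb_smult[OF fin, symmetric])
    ultimately have "a = j \<oplus> (z \<odot> (y \<ominus> i) \<oplus> comb ?r F')" using j(2) by simp
    also have "\<dots> = (j \<oplus> z \<odot> (y \<ominus> i)) \<oplus> comb ?r F'"
      using jc ic yc F'(4) by (intro a_assoc[symmetric] smult_closed minus_closed comb_closed)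
    finally have "a = (j \<oplus> z \<odot> (y \<ominus> i)) \<oplus> comb ?r F'" .
    moreover have "j \<oplus> z \<odot> (y \<ominus> i) \<in> W"
    proof (intro left_idealD(3)[OF W] left_ideal_smult[OF W] left_ideal_minus[OF W])
      show "j \<in> W" "y \<in> W" "i \<in> W" using j(1) i(1) y(1) VW by auto
    qed
    ultimately show ?thesis by blast
  qed
  then have "spans_mod W F'" using F' by (simp add: spans_mod_def)
  then show ?thesis using f(1) F'_def by blast
qed

text \<open>Multiplication by \<open>k\<close> embeds \<open>A / {a. a k \<in> V}\<close> into \<open>A / V\<close>, and subspaces of finite-dimensional spaces are
finite-dimensional.\<close>
lemma finite_codimension_quotient:
  assumes V: "left_ideal V A" and k: "k \<in> carrier A" and F: "spans_mod V F"
  shows "\<exists>B. spans_mod {a \<in> carrier A. a \<otimes> k \<in> V} B"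
proof -
  \<comment> \<open>The induction enlarges \<open>V\<close> by one vector of \<open>F\<close> at a time, so the claim is generalised from
    left ideals to subspaces.\<close>
  have "finite F \<Longrightarrow> V \<subseteq> carrier A \<Longrightarrow> (\<And>x y. x \<in> V \<Longrightarrow> y \<in> V \<Longrightarrow> x \<oplus> y \<in> V) \<Longrightarrow> 
    (\<And>x c. x \<in> V \<Longrightarrow> c \<odot> x \<in> V) \<Longrightarrow> spans_mod V F \<Longrightarrow> \<exists>B. spans_mod {a \<in> carrier A. a \<otimes> k \<in> V} B" for V
  proof (induction F arbitrary: V rule: finite_induct)
    case empty
    have "spans_mod {a \<in> carrier A. a \<otimes> k \<in> V} {}"
      unfolding spans_mod_def
    proof (intro conjI ballI)
      fix a assume a: "a \<in> carrier A"
      then obtain c i where "i \<in> V" "a \<otimes> k = i \<oplus> comb c {}"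
        using empty(4) k unfolding spans_mod_def by (metis m_closed)
      then have "a \<otimes> k \<in> V" using empty(1) by (auto simp: comb_def)
      then show "\<exists>c. \<exists>i\<in>{a \<in> carrier A. a \<otimes> k \<in> V}. a = i \<oplus> comb c {}"
        using a by (auto simp: comb_def)
    qed auto
    then show ?case ..
  next
    case (insert f F V)
    note V = insert.prems
    have fF: "f \<in> carrier A" "F \<subseteq> carrier A" using V(4) by (auto simp: spans_mod_def)
    define V' where "V' = {v \<oplus> c \<odot> f | v c. v \<in> V}"
    have "\<exists>B. spans_mod {a \<in> carrier A. a \<otimes> k \<in> V'} B"
    proof (rule insert.IH)
      show "V' \<subseteq> carrier A" unfolding V'_def using V(1) fF by auto
      show "x \<oplus> y \<in> V'" if xy: "x \<in> V'" "y \<in> V'" for x y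
      proof -
        obtain v c w d where *: "v \<in> V" "x = v \<oplus> c \<odot> f" "w \<in> V" "y = w \<oplus> d \<odot> f"
          using xy unfolding V'_def by blast
        moreover have "v \<in> carrier A" "w \<in> carrier A" using * V(1) by auto
        ultimately have "x \<oplus> y = (v \<oplus> w) \<oplus> (c + d) \<odot> f" using fF by (simp add: smult_l_distr a_ac)
        then show ?thesis unfolding V'_def using V(2) * by blast
      qed
      show "z \<odot> x \<in> V'" if x: "x \<in> V'" for x z
      proof -
        obtain v c where *: "v \<in> V" "x = v \<oplus> c \<odot> f" using x unfolding V'_def by blast
        moreover have "v \<in> carrier A" using * V(1) by auto
        ultimately have "z \<odot> x = z \<odot> v \<oplus> (z * c) \<odot> f" using fF by (simp add: smult_r_distr smult_assoc1)
        then show ?thesis unfolding V'_def using V(3) * by blast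
      qed
      show "spans_mod V' F"
        unfolding spans_mod_def
      proof (intro conjI ballI)
        fix a assume "a \<in> carrier A"
        then obtain c i where i: "i \<in> V" "a = i \<oplus> comb c (insert f F)"
          using V(4) unfolding spans_mod_def by blast
        have ic: "i \<in> carrier A" using i V(1) by auto
        have "a = (i \<oplus> c f \<odot> f) \<oplus> comb c F"
          using i ic fF insert by (simp add: comb_insert a_assoc)
        then show "\<exists>c. \<exists>i\<in>V'. a = i \<oplus> comb c F" unfolding V'_def using i(1) by blast
      qed (use fF insert in auto)
    qed
    then obtain B where B: "spans_mod {a \<in> carrier A. a \<otimes> k \<in> V'} B" by blast
    show ?case
    proof (cases "{a \<in> carrier A. a \<otimes> k \<in> V'} \<subseteq> {a \<in> carrier A. a \<otimes> k \<in> V}")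
      case True
      then have "spans_mod {a \<in> carrier A. a \<otimes> k \<in> V} B" using B unfolding spans_mod_def by blast
      then show ?thesis ..
    next
      case False
      then obtain b where b: "b \<in> carrier A" "b \<otimes> k \<in> V'" "b \<otimes> k \<notin> V" by blast
      obtain v c where v: "v \<in> V" "b \<otimes> k = v \<oplus> c \<odot> f" using b(2) unfolding V'_def by blast
      have vc: "v \<in> carrier A" using v V(1) by auto
      have c: "c \<noteq> 0" using b(3) v vc fF by auto
      have "spans_mod {a \<in> carrier A. a \<otimes> k \<in> V} (insert b B)"
      proof (rule spans_mod_insert[OF B b(1)])
        fix a assume "a \<in> {a \<in> carrier A. a \<otimes> k \<in> V'}"
        then obtain w d where a: "a \<in> carrier A" "w \<in> V" "a \<otimes> k = w \<oplus> d \<odot> f" unfolding V'_def by blast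
        have wc: "w \<in> carrier A" using a V(1) by auto
        define z where "z = d / c"
        let ?a' = "a \<oplus> (- z) \<odot> b"
        have "?a' \<otimes> k = (w \<oplus> d \<odot> f) \<oplus> (- z) \<odot> (v \<oplus> c \<odot> f)"
          using a v b k by (simp add: l_distr smult_assoc2)
        also have "(- z) \<odot> (v \<oplus> c \<odot> f) = (- z) \<odot> v \<oplus> (- d) \<odot> f"
          using c vc fF by (simp add: smult_r_distr z_def flip: smult_assoc1)
        also have "(w \<oplus> d \<odot> f) \<oplus> \<dots> = (w \<oplus> (- z) \<odot> v) \<oplus> (d + - d) \<odot> f"
          unfolding smult_l_distr[OF fF(1)] using wc vc fF by (simp add: a_ac)
        also have "\<dots> = w \<oplus> (- z) \<odot> v" using wc vc fF by simp
        finally have "?a' \<otimes> k \<in> V" using V(2,3) a(2) v(1) by simp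
        moreover have "a = ?a' \<oplus> z \<odot> b"
          using a(1) b(1) by (simp add: a_assoc smult_minus l_neg)
        ultimately show "\<exists>v\<in>{a \<in> carrier A. a \<otimes> k \<in> V}. \<exists>c. a = v \<oplus> c \<odot> b"
          using a(1) b(1) by (intro bexI[of _ ?a'] exI[of _ z]) auto
      qed auto
      then show ?thesis ..
    qed
  qed
  then show ?thesis using F left_idealD[OF V] left_ideal_smult[OF V] by (simp add: spans_mod_def)
qed

text \<open>If every maximal left ideal of finite codimension were finitely generated, then every simple finite-dimensional
module would be finitely presented, and extensions would pass this on to all finite-dimensional modules, in
particular to \<open>A / J\<close>. The proof isolates the first step at which this fails.\<close>
theorem non_finitely_generated_maximal_left_ideal:
  assumes "left_ideal J A" "finite_codimension J A" "\<not> finitely_generated_left_ideal J A"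
  shows "\<exists>M. maximal_left_ideal M A \<and> finite_codimension M A \<and> \<not> finitely_generated_left_ideal M A"
proof -
  define P where "P n \<longleftrightarrow> (\<exists>J F. left_ideal J A \<and> \<not> finitely_generated_left_ideal J A \<and> spans_mod J F \<and> card F = n)" for n
  have "\<exists>n. P n" using assms unfolding finite_codimension_iff P_def by blast
  then obtain d where d: "P d" "\<And>n. P n \<Longrightarrow> d \<le> n"
    by (metis LeastI_ex Least_le)
  obtain J F where J: "left_ideal J A" "\<not> finitely_generated_left_ideal J A" "spans_mod J F" "card F = d"
    using d(1) unfolding P_def by blast
  have above: "\<exists>F'. spans_mod K F' \<and> card F' < d \<and> finitely_generated_left_ideal K A"
    if K: "left_ideal K A" "J \<subset> K" for K
  proof -
    obtain f where f: "f \<in> F" "spans_mod K (F - {f})" using spans_mod_drop[OF J(1) K J(3)] by blast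
    have "card (F - {f}) < d" using f J(3,4) by (metis spans_mod_def card_Diff1_less)
    moreover have "finitely_generated_left_ideal K A"
    proof (rule ccontr)
      assume "\<not> finitely_generated_left_ideal K A"
      then have "P (card (F - {f}))" unfolding P_def using K(1) f(2) by blast
      from d(2)[OF this] calculation show False by linarith
    qed
    ultimately show ?thesis using f(2) by blast
  qed
  \<comment> \<open>The codimension of \<open>K\<close>. A left ideal of largest codimension strictly above \<open>J\<close> is minimal above \<open>J\<close>.\<close>
  define cd where "cd K = (LEAST n. \<exists>F. spans_mod K F \<and> card F = n)" for K
  have cd: "\<exists>F'. spans_mod K F' \<and> card F' = cd K" if "spans_mod K F'" for K F'
    unfolding cd_def by (rule LeastI_ex) (use that in blast)
  have cd_le: "cd K \<le> card F'" if "spans_mod K F'" for K F'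
    unfolding cd_def by (rule Least_le) (use that in blast)
  have "J \<noteq> carrier A"
  proof
    assume *: "J = carrier A"
    have "finitely_generated_left_ideal J A"
      unfolding finitely_generated_left_ideal_iff
    proof (intro conjI exI[of _ "{\<one>}"] allI impI)
      fix K assume K: "left_ideal K A" "{\<one>} \<subseteq> K"
      then have "x \<otimes> \<one> \<in> K" if "x \<in> carrier A" for x using that left_idealD(4)[OF K(1)] by blast
      then show "J \<subseteq> K" using * by auto
    qed (use J * in auto)
    then show False using J by simp
  qed
  then have "left_ideal (carrier A) A \<and> J \<subset> carrier A"
    using left_ideal_carrier left_idealD(1)[OF J(1)] by auto
  moreover have "\<forall>K. left_ideal K A \<and> J \<subset> K \<longrightarrow> cd K < Suc d"
    using above cd_le by (meson le_less_trans less_SucI)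
  ultimately obtain K where K: "left_ideal K A" "J \<subset> K"
    and Kmax: "\<And>K'. left_ideal K' A \<Longrightarrow> J \<subset> K' \<Longrightarrow> cd K' \<le> cd K"
    using ex_has_greatest_nat[of "\<lambda>K. left_ideal K A \<and> J \<subset> K" "carrier A" cd "Suc d"] by blast
  have Kmin: "K' = K" if K': "left_ideal K' A" "J \<subset> K'" "K' \<subseteq> K" for K'
  proof (rule ccontr)
    assume "K' \<noteq> K"
    then have "K' \<subset> K" using K' by blast
    obtain F' where F': "spans_mod K' F'" "card F' = cd K'" using cd above[OF K'(1,2)] by blast
    obtain f where f: "f \<in> F'" "spans_mod K (F' - {f})"
      using spans_mod_drop[OF K'(1) K(1) \<open>K' \<subset> K\<close> F'(1)] by blast
    have "cd K < cd K'"
      using cd_le[OF f(2)] F' f by (metis spans_mod_def card_Diff1_less le_less_trans)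
    then show False using Kmax[OF K'(1,2)] by simp
  qed
  obtain k where k: "k \<in> K" "k \<notin> J" using K(2) by blast
  have kc: "k \<in> carrier A" using k left_idealD(1)[OF K(1)] by blast
  have Kadj: "adjoin J k = K"
    using k K J(1) by (intro Kmin left_ideal_adjoin[OF _ kc] adjoin_minimal)
      (use adjoin_subset[OF J(1) kc] in blast)+
  define M where "M = {a \<in> carrier A. a \<otimes> k \<in> J}"
  have M: "left_ideal M A" unfolding M_def by (rule left_ideal_quotient[OF J(1) kc])
  have "maximal_left_ideal M A"
  proof (intro maximal_left_ideal.intro maximal_left_ideal_axioms.intro M)
    have "\<one> \<notin> M" using k kc by (simp add: M_def)
    then show "carrier A \<noteq> M" by auto
    fix M' assume M': "left_ideal M' A" "M \<subseteq> M'" "M' \<subseteq> carrier A"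
    show "M' = M \<or> M' = carrier A"
    proof (rule disjCI)
      assume "M' \<noteq> carrier A"
      have "M' \<subseteq> M"
      proof (rule ccontr)
        assume "\<not> M' \<subseteq> M"
        then obtain a where a: "a \<in> M'" "a \<notin> M" by blast
        have ac: "a \<in> carrier A" using a M' by auto
        have ak: "a \<otimes> k \<in> carrier A" "a \<otimes> k \<notin> J" using a ac kc by (auto simp: M_def)
        have "a \<otimes> k \<in> K" using left_idealD(4)[OF K(1) k(1) ac] .
        then have "adjoin J (a \<otimes> k) = K"
          using K J(1) ak(2) by (intro Kmin left_ideal_adjoin[OF _ ak(1)] adjoin_minimal)
            (use adjoin_subset[OF J(1) ak(1)] in blast)+
        then obtain b j where bj: "b \<in> carrier A" "j \<in> J" "k = b \<otimes> (a \<otimes> k) \<oplus> j"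
          using k(1) unfolding adjoin_def by blast
        have jc: "j \<in> carrier A" using bj(2) left_idealD(1)[OF J(1)] by blast
        have c: "b \<otimes> (a \<otimes> k) \<in> carrier A" using bj(1) ak(1) by simp
        have "(z \<oplus> j) \<ominus> z = j" if "z \<in> carrier A" for z
          using that jc by (simp add: a_minus_def a_comm[of z j] a_assoc r_neg)
        then have "k \<ominus> b \<otimes> (a \<otimes> k) = j" using bj(3) c by metis
        moreover have "(\<one> \<ominus> b \<otimes> a) \<otimes> k = k \<ominus> b \<otimes> (a \<otimes> k)"
          using bj(1) ac kc by (simp add: a_minus_def l_distr l_minus m_assoc)
        ultimately have "(\<one> \<ominus> b \<otimes> a) \<otimes> k = j" by simp
        then have "\<one> \<ominus> b \<otimes> a \<in> M" using bj(1,2) ac by (simp add: M_def)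
        then have "(\<one> \<ominus> b \<otimes> a) \<oplus> b \<otimes> a \<in> M'"
          using M' a(1) bj(1) left_idealD(3,4)[OF M'(1)] by blast
        moreover have "(\<one> \<ominus> b \<otimes> a) \<oplus> b \<otimes> a = \<one>"
          using bj(1) ac by (simp add: a_minus_def a_assoc l_neg)
        ultimately have one: "\<one> \<in> M'" by simp
        have "x \<in> M'" if "x \<in> carrier A" for x using left_idealD(4)[OF M'(1) one that] that by simp
        then show False using \<open>M' \<noteq> carrier A\<close> M'(3) by blast
      qed
      then show "M' = M" using M'(2) by blast
    qed
  qed
  moreover have "finite_codimension M A"
    unfolding M_def finite_codimension_iff by (rule finite_codimension_quotient[OF J(1) kc J(3)])
  moreover have "\<not> finitely_generated_left_ideal M A"
  proof
    assume "finitely_generated_left_ideal M A"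
    then obtain S where S: "finite S" "S \<subseteq> M" "\<And>I. left_ideal I A \<Longrightarrow> S \<subseteq> I \<Longrightarrow> M \<subseteq> I"
      unfolding finitely_generated_left_ideal_iff by blast
    have "finitely_generated_left_ideal K A" using above[OF K] by blast
    then obtain B where B: "finite B" "B \<subseteq> K" "\<And>I. left_ideal I A \<Longrightarrow> B \<subseteq> I \<Longrightarrow> K \<subseteq> I"
      unfolding finitely_generated_left_ideal_iff by blast
    have "\<exists>c j. c \<in> carrier A \<and> j \<in> J \<and> b = c \<otimes> k \<oplus> j" if "b \<in> B" for b
    proof -
      have "b \<in> adjoin J k" using that B(2) Kadj by blast
      then show ?thesis unfolding adjoin_def by blast
    qed
    then obtain c j where cj: "\<And>b. b \<in> B \<Longrightarrow> c b \<in> carrier A \<and> j b \<in> J \<and> b = c b \<otimes> k \<oplus> j b"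
      by metis
    \<comment> \<open>Generators of \<open>K\<close> have the form \<open>c k + j\<close>. Their remainders \<open>j\<close> together with \<open>M k\<close> generate \<open>J\<close>.\<close>
    let ?S = "(\<lambda>m. m \<otimes> k) ` S \<union> j ` B"
    have "?S \<subseteq> J" using S cj by (auto simp: M_def)
    moreover have "J \<subseteq> I0" if I0: "left_ideal I0 A" "?S \<subseteq> I0" for I0
    proof
      fix y assume y: "y \<in> J"
      \<comment> \<open>Inside \<open>J\<close>, an element of the form \<open>a k\<close> has \<open>a \<in> M\<close>.\<close>
      define I where "I = I0 \<inter> J"
      have I: "left_ideal I A" "?S \<subseteq> I" "I \<subseteq> J"
        using I0 \<open>?S \<subseteq> J\<close> left_ideal_inter[OF I0(1) J(1)] by (auto simp: I_def)
      have "M \<subseteq> {a \<in> carrier A. a \<otimes> k \<in> I}"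
        using S I left_ideal_quotient[OF I(1) kc] by (intro S(3)) (auto simp: M_def)
      then have MI: "a \<otimes> k \<in> I" if "a \<in> M" for a using that by blast
      have "B \<subseteq> adjoin I k" using cj I(2) unfolding adjoin_def by fastforce
      then have "K \<subseteq> adjoin I k" using B(3) left_ideal_adjoin[OF I(1) kc] by blast
      then obtain a u where u: "y = a \<otimes> k \<oplus> u" "a \<in> carrier A" "u \<in> I"
        using y K(2) unfolding adjoin_def by blast
      have uc: "u \<in> carrier A" using u(3) left_idealD(1)[OF I(1)] by blast
      have "a \<otimes> k = y \<ominus> u" using u uc kc by (simp add: a_minus_def a_assoc r_neg)
      then have "a \<otimes> k \<in> J" using left_ideal_minus[OF J(1) y] u(3) I(3) by auto
      then have "a \<otimes> k \<in> I" using MI u(2) by (simp add: M_def)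
      then have "y \<in> I" using u left_idealD(3)[OF I(1)] by simp
      then show "y \<in> I0" by (simp add: I_def)
    qed
    ultimately have "finitely_generated_left_ideal J A"
      unfolding finitely_generated_left_ideal_iff using J(1) S(1) B(1) by (intro conjI exI[of _ ?S]) auto
    then show False using J(2) by simp
  qed
  ultimately show ?thesis by blast
qed

end

section \<open>The Beurling algebra\<close>

lemma summable_on_cmod_iff:
  fixes f :: "'a \<Rightarrow> complex"
  shows "(\<lambda>x. cmod (f x)) summable_on S \<longleftrightarrow> f summable_on S"
  using summable_on_iff_abs_summable_on_complex[of f S] by simp

lemma summable_on_product:
  fixes f :: "'a \<Rightarrow> real" and g :: "'b \<Rightarrow> real"
  assumes "f summable_on S" "g summable_on T" "\<And>x. x \<in> S \<Longrightarrow> 0 \<le> f x" "\<And>y. y \<in> T \<Longrightarrow> 0 \<le> g y"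
  shows "(\<lambda>(x, y). f x * g y) summable_on S \<times> T"
proof (rule summable_on_SigmaI)
  show "((\<lambda>y. (case (x, y) of (x, y) \<Rightarrow> f x * g y)) has_sum (f x * infsum g T)) T" for x
    using has_sum_cmult_right[OF has_sum_infsum[OF assms(2)], of "f x"] by simp
  show "(\<lambda>x. f x * infsum g T) summable_on S" using assms(1) by (rule summable_on_cmult_left)
qed (use assms in auto)

lemma summable_on_sum_finite:
  fixes f :: "'i \<Rightarrow> 'a \<Rightarrow> 'b::topological_comm_monoid_add"
  assumes "finite I" "\<And>i. i \<in> I \<Longrightarrow> f i summable_on S"
  shows "(\<lambda>x. \<Sum>i\<in>I. f i x) summable_on S"
  using assms by (induction rule: finite_induct) (auto intro: summable_on_add)
lemma infsum_single:
  fixes f :: "'a \<Rightarrow> 'c::{comm_monoid_add,t2_space}"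
  assumes "a \<in> S" "\<And>x. x \<in> S \<Longrightarrow> x \<noteq> a \<Longrightarrow> f x = 0"
  shows "infsum f S = f a"
proof -
  have "infsum f S = infsum f {a}" by (rule infsum_cong_neutral) (use assms in auto)
  then show ?thesis by simp
qed

locale beurling = group G for G :: "('a, 'm) monoid_scheme" (structure) +
  fixes \<omega> :: "'a \<Rightarrow> real"
  assumes weight: "weight G \<omega>"
begin

lemma weight_ge_1: "s \<in> carrier G \<Longrightarrow> 1 \<le> \<omega> s"
  and weight_mult: "s \<in> carrier G \<Longrightarrow> t \<in> carrier G \<Longrightarrow> \<omega> (s \<otimes> t) \<le> \<omega> s * \<omega> t"
  and weight_one: "\<omega> \<one> = 1"
  using weight by (auto simp: weight_def)

lemma weight_ge_0: "s \<in> carrier G \<Longrightarrow> 0 \<le> \<omega> s"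
  using weight_ge_1[of s] by simp

abbreviation A where "A \<equiv> beurling_algebra G \<omega>"

lemma mem_A_iff: "f \<in> carrier A \<longleftrightarrow>
    (\<forall>t. t \<notin> carrier G \<longrightarrow> f t = 0) \<and> (\<lambda>t. cmod (f t) * \<omega> t) summable_on carrier G"
  by (simp add: beurling_algebra_def)

lemma A_outside: "f \<in> carrier A \<Longrightarrow> t \<notin> carrier G \<Longrightarrow> f t = 0"
  and A_summable: "f \<in> carrier A \<Longrightarrow> (\<lambda>t. cmod (f t) * \<omega> t) summable_on carrier G"
  by (simp_all add: mem_A_iff)

lemma A_mult: "f \<otimes>\<^bsub>A\<^esub> g = (\<lambda>t. if t \<in> carrier G then \<Sum>\<^sub>\<infinity>s\<in>carrier G. f s * g (inv s \<otimes> t) else 0)"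
  and A_one: "\<one>\<^bsub>A\<^esub> = (\<lambda>t. if t = \<one> then 1 else 0)"
  and A_zero: "\<zero>\<^bsub>A\<^esub> = (\<lambda>t. 0)"
  and A_add: "f \<oplus>\<^bsub>A\<^esub> g = (\<lambda>t. f t + g t)"
  and A_smult: "c \<odot>\<^bsub>A\<^esub> f = (\<lambda>t. c * f t)"
  by (simp_all add: beurling_algebra_def)

text \<open>A function \<open>u\<close> with \<open>|u| \<le> K * \<omega>\<close> is a bounded functional on \<open>\<ell>\<^sup>1(G, \<omega>)\<close>, by the pairing
\<open>f \<mapsto> \<Sum>t. f t * u t\<close>.\<close>
definition dominated :: "('a \<Rightarrow> complex) \<Rightarrow> real \<Rightarrow> bool" where
  "dominated u K \<longleftrightarrow> (\<forall>t\<in>carrier G. cmod (u t) \<le> K * \<omega> t)"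

lemma pairing_summable:
  assumes f: "f \<in> carrier A" and u: "dominated u K"
  shows "(\<lambda>t. f t * u t) summable_on carrier G"
proof (rule abs_summable_summable, rule abs_summable_on_comparison_test')
  show "(\<lambda>t. K * (cmod (f t) * \<omega> t)) summable_on carrier G"
    by (rule summable_on_cmult_right[OF A_summable[OF f]])
  show "cmod (f t * u t) \<le> K * (cmod (f t) * \<omega> t)" if "t \<in> carrier G" for t
    using mult_left_mono[of "cmod (u t)" "K * \<omega> t" "cmod (f t)"] u that
    by (simp add: norm_mult dominated_def mult_ac)
qed

lemma dominated_nonneg: "dominated u K \<Longrightarrow> 0 \<le> K"
  unfolding dominated_def using weight_one norm_ge_zero[of "u \<one>"] one_closed
  by (metis mult.right_neutral order_trans)

lemma dominated_shift:
  assumes u: "dominated u K" and s: "s \<in> carrier G"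
  shows "dominated (\<lambda>t. u (s \<otimes> t)) (K * \<omega> s)"
  unfolding dominated_def
proof
  fix t assume t: "t \<in> carrier G"
  have "cmod (u (s \<otimes> t)) \<le> K * \<omega> (s \<otimes> t)" using u s t by (simp add: dominated_def)
  also have "\<dots> \<le> K * (\<omega> s * \<omega> t)"
    using weight_mult[OF s t] dominated_nonneg[OF u] by (rule mult_left_mono)
  finally show "cmod (u (s \<otimes> t)) \<le> K * \<omega> s * \<omega> t" by (simp add: mult_ac)
qed

text \<open>Both families agree after the substitution \<open>t = s r\<close>. The first is dominated by \<open>f \<omega>\<close> tensor \<open>g \<omega>\<close>, because \<open>\<omega>\<close>
is submultiplicative.\<close>
lemma double_summable:
  assumes f: "f \<in> carrier A" and g: "g \<in> carrier A" and u: "dominated u K"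
  shows "(\<lambda>(s, r). f s * g r * u (s \<otimes> r)) abs_summable_on carrier G \<times> carrier G"
    and "(\<lambda>(s, t). f s * g (inv s \<otimes> t) * u t) abs_summable_on carrier G \<times> carrier G"
proof -
  have "(\<lambda>p. case p of (s, r) \<Rightarrow> K * ((cmod (f s) * \<omega> s) * (cmod (g r) * \<omega> r))) summable_on carrier G \<times> carrier G"
    using summable_on_cmult_right[OF summable_on_product[OF A_summable[OF f] A_summable[OF g]], of K]
    by (simp add: weight_ge_0 case_prod_unfold)
  then show *: "(\<lambda>(s, r). f s * g r * u (s \<otimes> r)) abs_summable_on carrier G \<times> carrier G"
  proof (rule abs_summable_on_comparison_test', clarify)
    fix s r assume sr: "s \<in> carrier G" "r \<in> carrier G"
    have "cmod (u (s \<otimes> r)) \<le> K * \<omega> s * \<omega> r"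
      using dominated_shift[OF u sr(1)] sr by (simp add: dominated_def)
    then have "cmod (f s) * cmod (g r) * cmod (u (s \<otimes> r)) \<le> cmod (f s) * cmod (g r) * (K * \<omega> s * \<omega> r)"
      by (intro mult_left_mono) auto
    then show "cmod (f s * g r * u (s \<otimes> r)) \<le> K * ((cmod (f s) * \<omega> s) * (cmod (g r) * \<omega> r))"
      by (simp add: norm_mult mult_ac)
  qed
  have "(\<lambda>p. cmod (case p of (s, t) \<Rightarrow> f s * g (inv s \<otimes> t) * u t)) summable_on carrier G \<times> carrier G \<longleftrightarrow>
    (\<lambda>p. cmod (case p of (s, r) \<Rightarrow> f s * g r * u (s \<otimes> r))) summable_on carrier G \<times> carrier G"
    by (rule summable_on_reindex_bij_witness[where i = "\<lambda>(s, r). (s, s \<otimes> r)" and j = "\<lambda>(s, t). (s, inv s \<otimes> t)"])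
      (auto simp: m_assoc[symmetric])
  with * show "(\<lambda>(s, t). f s * g (inv s \<otimes> t) * u t) abs_summable_on carrier G \<times> carrier G" by simp
qed

lemma translate_sum:
  assumes "s \<in> carrier G"
  shows "(\<Sum>\<^sub>\<infinity>t\<in>carrier G. h (inv s \<otimes> t) t) = (\<Sum>\<^sub>\<infinity>r\<in>carrier G. h r (s \<otimes> r))"
  by (rule infsum_reindex_bij_witness[where i = "\<lambda>r. s \<otimes> r" and j = "\<lambda>t. inv s \<otimes> t"])
    (use assms in \<open>auto simp: m_assoc[symmetric]\<close>)

text \<open>Convolution is dual to translation of functionals. All computations with products, associativity included, go
through this identity, so that the order of summation is interchanged only here.\<close>
lemma pairing_mult:
  assumes f: "f \<in> carrier A" and g: "g \<in> carrier A" and u: "dominated u K"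
  shows "(\<Sum>\<^sub>\<infinity>t\<in>carrier G. (f \<otimes>\<^bsub>A\<^esub> g) t * u t)
    = (\<Sum>\<^sub>\<infinity>s\<in>carrier G. f s * (\<Sum>\<^sub>\<infinity>r\<in>carrier G. g r * u (s \<otimes> r)))"
proof -
  have "(\<Sum>\<^sub>\<infinity>t\<in>carrier G. (f \<otimes>\<^bsub>A\<^esub> g) t * u t)
      = (\<Sum>\<^sub>\<infinity>t\<in>carrier G. \<Sum>\<^sub>\<infinity>s\<in>carrier G. f s * g (inv s \<otimes> t) * u t)"
    by (rule infsum_cong) (simp add: A_mult infsum_cmult_left')
  also have "\<dots> = (\<Sum>\<^sub>\<infinity>s\<in>carrier G. \<Sum>\<^sub>\<infinity>t\<in>carrier G. f s * g (inv s \<otimes> t) * u t)"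
    by (rule infsum_swap_banach[symmetric], rule abs_summable_summable)
      (rule double_summable(2)[OF f g u])
  also have "\<dots> = (\<Sum>\<^sub>\<infinity>s\<in>carrier G. \<Sum>\<^sub>\<infinity>r\<in>carrier G. f s * g r * u (s \<otimes> r))"
    by (rule infsum_cong) (rule translate_sum)
  also have "\<dots> = (\<Sum>\<^sub>\<infinity>s\<in>carrier G. f s * (\<Sum>\<^sub>\<infinity>r\<in>carrier G. g r * u (s \<otimes> r)))"
    by (rule infsum_cong) (simp add: infsum_cmult_right' mult.assoc)
  finally show ?thesis .
qed

text \<open>Summability of the double family with \<open>u = \<omega>\<close> gives that of its marginal.\<close>
lemma mult_closed_A:
  assumes f: "f \<in> carrier A" and g: "g \<in> carrier A"
  shows "f \<otimes>\<^bsub>A\<^esub> g \<in> carrier A"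
proof -
  have u: "dominated (\<lambda>t. of_real (\<omega> t)) 1" using weight_ge_0 by (auto simp: dominated_def)
  have "(\<lambda>(s, t). f s * g (inv s \<otimes> t) * of_real (\<omega> t)) summable_on carrier G \<times> carrier G"
    by (rule abs_summable_summable) (rule double_summable(2)[OF f g u])
  then have "(\<lambda>(t, s). f s * g (inv s \<otimes> t) * of_real (\<omega> t)) summable_on carrier G \<times> carrier G"
    by (subst (asm) summable_on_reindex_bij_witness[where i = prod.swap and j = prod.swap
          and h = "\<lambda>(t, s). f s * g (inv s \<otimes> t) * of_real (\<omega> t)" and T = "carrier G \<times> carrier G"]) auto
  then have "(\<lambda>t. \<Sum>\<^sub>\<infinity>s\<in>carrier G. f s * g (inv s \<otimes> t) * of_real (\<omega> t)) summable_on carrier G"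
    by (rule summable_on_Sigma_banach)
  then have "(\<lambda>t. (f \<otimes>\<^bsub>A\<^esub> g) t * of_real (\<omega> t)) summable_on carrier G"
    by (rule summable_on_cong[THEN iffD1, rotated]) (simp add: A_mult infsum_cmult_left')
  then have "(\<lambda>t. cmod ((f \<otimes>\<^bsub>A\<^esub> g) t * of_real (\<omega> t))) summable_on carrier G"
    by (simp only: summable_on_cmod_iff)
  then have "(\<lambda>t. cmod ((f \<otimes>\<^bsub>A\<^esub> g) t) * \<omega> t) summable_on carrier G"
    by (rule summable_on_cong[THEN iffD1, rotated]) (simp add: norm_mult weight_ge_0)
  then show ?thesis by (simp add: mem_A_iff A_mult)
qed

text \<open>The norm of \<open>h\<close> bounds all its values, so the functional that evaluates a convolution with \<open>h\<close> at \<open>t\<close> is bounded.\<close>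
lemma dominated_reflected:
  assumes h: "h \<in> carrier A" and t: "t \<in> carrier G"
  shows "\<exists>K. dominated (\<lambda>r. h (inv r \<otimes> t)) K"
proof -
  define K where "K = (\<Sum>\<^sub>\<infinity>t\<in>carrier G. cmod (h t) * \<omega> t)"
  have "cmod (h s) \<le> K" if s: "s \<in> carrier G" for s
  proof -
    have "cmod (h s) * 1 \<le> cmod (h s) * \<omega> s" using weight_ge_1[OF s] by (intro mult_left_mono) auto
    also have "\<dots> \<le> K" unfolding K_def
      using finite_sum_le_infsum[OF A_summable[OF h], of "{s}"] s weight_ge_0 by simp
    finally show ?thesis by simp
  qed
  moreover from this[OF one_closed] have "0 \<le> K" using norm_ge_zero order_trans by blast
  moreover have "K \<le> K * \<omega> r" if "r \<in> carrier G" for r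
    using mult_left_mono[OF weight_ge_1[OF that] \<open>0 \<le> K\<close>] by simp
  ultimately have "dominated (\<lambda>r. h (inv r \<otimes> t)) K"
    unfolding dominated_def using t by (meson inv_closed m_closed order_trans)
  then show ?thesis ..
qed

lemma convolution_eq:
  assumes "t \<in> carrier G"
  shows "(f \<otimes>\<^bsub>A\<^esub> g) t = (\<Sum>\<^sub>\<infinity>s\<in>carrier G. f s * g (inv s \<otimes> t))"
  using assms by (simp add: A_mult)

lemma mult_assoc_A:
  assumes f: "f \<in> carrier A" and g: "g \<in> carrier A" and h: "h \<in> carrier A"
  shows "(f \<otimes>\<^bsub>A\<^esub> g) \<otimes>\<^bsub>A\<^esub> h = f \<otimes>\<^bsub>A\<^esub> (g \<otimes>\<^bsub>A\<^esub> h)"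
proof
  fix t
  show "((f \<otimes>\<^bsub>A\<^esub> g) \<otimes>\<^bsub>A\<^esub> h) t = (f \<otimes>\<^bsub>A\<^esub> (g \<otimes>\<^bsub>A\<^esub> h)) t"
  proof (cases "t \<in> carrier G")
    case t: True
    obtain K where K: "dominated (\<lambda>r. h (inv r \<otimes> t)) K" using dominated_reflected[OF h t] by blast
    have "((f \<otimes>\<^bsub>A\<^esub> g) \<otimes>\<^bsub>A\<^esub> h) t
        = (\<Sum>\<^sub>\<infinity>s\<in>carrier G. f s * (\<Sum>\<^sub>\<infinity>r\<in>carrier G. g r * h (inv (s \<otimes> r) \<otimes> t)))"
      unfolding convolution_eq[OF t] by (rule pairing_mult[OF f g K])
    also have "\<dots> = (\<Sum>\<^sub>\<infinity>s\<in>carrier G. f s * (g \<otimes>\<^bsub>A\<^esub> h) (inv s \<otimes> t))"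
      using t by (intro infsum_cong) (simp add: convolution_eq inv_mult_group m_assoc cong: infsum_cong)
    also have "\<dots> = (f \<otimes>\<^bsub>A\<^esub> (g \<otimes>\<^bsub>A\<^esub> h)) t" by (simp only: convolution_eq[OF t])
    finally show ?thesis .
  qed (simp add: A_mult)
qed

lemma convolution_summable:
  assumes "h \<in> carrier A" "t \<in> carrier G" "f \<in> carrier A"
  shows "(\<lambda>s. f s * h (inv s \<otimes> t)) summable_on carrier G"
  using dominated_reflected[OF assms(1,2)] pairing_summable[OF assms(3)] by blast

lemma add_closed_A:
  assumes f: "f \<in> carrier A" and g: "g \<in> carrier A"
  shows "f \<oplus>\<^bsub>A\<^esub> g \<in> carrier A"
proof -
  have "(\<lambda>t. cmod (f t + g t) * \<omega> t) summable_on carrier G"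
  proof (rule summable_on_comparison_test)
    show "(\<lambda>t. cmod (f t) * \<omega> t + cmod (g t) * \<omega> t) summable_on carrier G"
      by (rule summable_on_add[OF A_summable[OF f] A_summable[OF g]])
    show "cmod (f t + g t) * \<omega> t \<le> cmod (f t) * \<omega> t + cmod (g t) * \<omega> t" if "t \<in> carrier G" for t
      using mult_right_mono[OF norm_triangle_ineq weight_ge_0[OF that]] by (simp add: distrib_right)
  qed (simp add: weight_ge_0)
  then show ?thesis using f g by (simp add: mem_A_iff A_add)
qed

lemma smult_closed_A: "f \<in> carrier A \<Longrightarrow> c \<odot>\<^bsub>A\<^esub> f \<in> carrier A"
  using summable_on_cmult_right[of "\<lambda>t. cmod (f t) * \<omega> t" "carrier G" "cmod c"]
  by (simp add: mem_A_iff A_smult norm_mult mult.assoc)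

lemma mem_A_finite_support:
  assumes "finite {t. f t \<noteq> 0}" "{t. f t \<noteq> 0} \<subseteq> carrier G"
  shows "f \<in> carrier A"
proof -
  have "(\<lambda>t. cmod (f t) * \<omega> t) summable_on carrier G"
    by (rule finite_nonzero_values_imp_summable_on) (rule finite_subset[OF _ assms(1)], auto)
  then show ?thesis using assms(2) by (auto simp: mem_A_iff)
qed

lemma complex_algebra: "complex_algebra A"
proof (intro complex_algebra.intro ringI abelian_groupI monoidI complex_algebra_axioms.intro)
  show "\<zero>\<^bsub>A\<^esub> \<in> carrier A" by (simp add: mem_A_iff A_zero)
  show "\<exists>y\<in>carrier A. y \<oplus>\<^bsub>A\<^esub> x = \<zero>\<^bsub>A\<^esub>" if "x \<in> carrier A" for x
    using smult_closed_A[OF that, of "- 1"]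
    by (intro bexI[of _ "(- 1) \<odot>\<^bsub>A\<^esub> x"]) (auto simp: A_add A_smult A_zero)
  show "\<one>\<^bsub>A\<^esub> \<in> carrier A" by (rule mem_A_finite_support) (auto simp: A_one)
  show "\<one>\<^bsub>A\<^esub> \<otimes>\<^bsub>A\<^esub> x = x" if x: "x \<in> carrier A" for x
  proof
    fix t
    show "(\<one>\<^bsub>A\<^esub> \<otimes>\<^bsub>A\<^esub> x) t = x t"
      using x by (cases "t \<in> carrier G") (simp_all add: convolution_eq infsum_single[of \<one>] A_one A_mult A_outside)
  qed
  show "x \<otimes>\<^bsub>A\<^esub> \<one>\<^bsub>A\<^esub> = x" if x: "x \<in> carrier A" for x
  proof
    fix t
    show "(x \<otimes>\<^bsub>A\<^esub> \<one>\<^bsub>A\<^esub>) t = x t"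
    proof (cases "t \<in> carrier G")
      case t: True
      have "inv s \<otimes> t \<noteq> \<one>" if "s \<in> carrier G" "s \<noteq> t" for s
        using that t by (metis inv_closed inv_equality inv_inv)
      then show ?thesis using t x by (simp add: convolution_eq infsum_single[of t] A_one)
    qed (simp add: A_mult A_outside[OF x])
  qed
  show "(x \<oplus>\<^bsub>A\<^esub> y) \<otimes>\<^bsub>A\<^esub> z = x \<otimes>\<^bsub>A\<^esub> z \<oplus>\<^bsub>A\<^esub> y \<otimes>\<^bsub>A\<^esub> z"
    if "x \<in> carrier A" "y \<in> carrier A" "z \<in> carrier A" for x y z
  proof
    fix t
    show "((x \<oplus>\<^bsub>A\<^esub> y) \<otimes>\<^bsub>A\<^esub> z) t = (x \<otimes>\<^bsub>A\<^esub> z \<oplus>\<^bsub>A\<^esub> y \<otimes>\<^bsub>A\<^esub> z) t"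
    proof (cases "t \<in> carrier G")
      case t: True
      then show ?thesis using that
        by (simp add: convolution_eq A_add distrib_right infsum_add convolution_summable)
    qed (simp add: A_mult A_add)
  qed
  show "z \<otimes>\<^bsub>A\<^esub> (x \<oplus>\<^bsub>A\<^esub> y) = z \<otimes>\<^bsub>A\<^esub> x \<oplus>\<^bsub>A\<^esub> z \<otimes>\<^bsub>A\<^esub> y"
    if "x \<in> carrier A" "y \<in> carrier A" "z \<in> carrier A" for x y z
  proof
    fix t
    show "(z \<otimes>\<^bsub>A\<^esub> (x \<oplus>\<^bsub>A\<^esub> y)) t = (z \<otimes>\<^bsub>A\<^esub> x \<oplus>\<^bsub>A\<^esub> z \<otimes>\<^bsub>A\<^esub> y) t"
    proof (cases "t \<in> carrier G")
      case t: True
      then show ?thesis using that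
        by (simp add: convolution_eq A_add distrib_left infsum_add convolution_summable)
    qed (simp add: A_mult A_add)
  qed
  show "(c \<odot>\<^bsub>A\<^esub> x) \<otimes>\<^bsub>A\<^esub> y = c \<odot>\<^bsub>A\<^esub> (x \<otimes>\<^bsub>A\<^esub> y)" for c x y
    by (auto simp: A_mult A_smult infsum_cmult_right' mult.assoc)
qed (auto simp: add_closed_A mult_closed_A mult_assoc_A smult_closed_A, auto simp: A_add A_zero A_smult algebra_simps)

sublocale A: complex_algebra A by (rule complex_algebra)

end

section \<open>The left ideal induced from a positive character\<close>

text \<open>\<open>T\<close> represents the right cosets of \<open>H\<close> through inverses: \<open>g \<otimes> t \<in> H\<close> means that \<open>inv t\<close> lies in the coset of
\<open>g\<close>. This is the form in which \<open>T\<close> meets the functionals \<open>r \<mapsto> \<xi> (g \<otimes> r)\<close> below.\<close>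
locale beurling_character = beurling +
  fixes H T :: "'a set" and \<chi> :: "'a \<Rightarrow> real"
  assumes H: "subgroup H G"
    and T: "finite T" "T \<subseteq> carrier G"
    and transversal: "g \<in> carrier G \<Longrightarrow> \<exists>!t. t \<in> T \<and> g \<otimes> t \<in> H"
    and character_pos: "h \<in> H \<Longrightarrow> 0 < \<chi> h"
    and character_mult: "h \<in> H \<Longrightarrow> k \<in> H \<Longrightarrow> \<chi> (h \<otimes> k) = \<chi> h * \<chi> k"
    and character_le: "h \<in> H \<Longrightarrow> \<chi> h \<le> \<omega> h"
begin

lemma H_carrier [simp]: "h \<in> H \<Longrightarrow> h \<in> carrier G"
  using subgroup.mem_carrier[OF H] .

lemma H_closed [simp]: "\<one> \<in> H" "h \<in> H \<Longrightarrow> k \<in> H \<Longrightarrow> h \<otimes> k \<in> H" "h \<in> H \<Longrightarrow> inv h \<in> H"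
  using H by (simp_all add: subgroup.one_closed subgroup.m_closed subgroup.m_inv_closed)

lemma mult_in_H_iff: "h \<in> H \<Longrightarrow> r \<in> carrier G \<Longrightarrow> h \<otimes> r \<in> H \<longleftrightarrow> r \<in> H"
  by (metis H_carrier H_closed(2,3) inv_solve_left)

definition \<xi> :: "'a \<Rightarrow> complex" where
  xi_def: "\<xi> r = (if r \<in> H then of_real (\<chi> r) else 0)"

lemma xi_mult: "h \<in> H \<Longrightarrow> r \<in> carrier G \<Longrightarrow> \<xi> (h \<otimes> r) = of_real (\<chi> h) * \<xi> r"
  by (simp add: xi_def mult_in_H_iff character_mult)

lemma dominated_xi: "dominated \<xi> 1"
  using character_le character_pos weight_ge_0 by (auto simp: dominated_def xi_def less_imp_le)

text \<open>The functionals \<open>f \<mapsto> \<Sum>r. f r * \<xi> (t \<otimes> r)\<close> sum \<open>f\<close> against \<open>\<chi>\<close> over the left coset of \<open>H\<close> that contains \<open>inv t\<close>,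
up to a scalar. Their common kernel is the left ideal generated by the kernel of \<open>\<chi>\<close> on \<open>\<ell>\<^sup>1(H, \<omega>)\<close>.\<close>
definition J :: "('a \<Rightarrow> complex) set" where
  "J = {f \<in> carrier A. \<forall>t\<in>carrier G. (\<Sum>\<^sub>\<infinity>r\<in>carrier G. f r * \<xi> (t \<otimes> r)) = 0}"

lemma J_summable: "f \<in> carrier A \<Longrightarrow> t \<in> carrier G \<Longrightarrow> (\<lambda>r. f r * \<xi> (t \<otimes> r)) summable_on carrier G"
  using pairing_summable dominated_shift[OF dominated_xi] by blast

lemma left_ideal_J: "left_ideal J A"
proof (rule A.left_idealI, goal_cases)
  case (3 f g)
  then have fg: "f \<in> carrier A" "g \<in> carrier A" by (auto simp: J_def)
  have "(\<Sum>\<^sub>\<infinity>r\<in>carrier G. (f \<oplus>\<^bsub>A\<^esub> g) r * \<xi> (t \<otimes> r)) = 0" if "t \<in> carrier G" for t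
    using 3 fg that by (simp add: J_def A_add distrib_right infsum_add J_summable)
  then show ?case using fg by (simp add: J_def)
next
  case (4 f x)
  have "(\<Sum>\<^sub>\<infinity>r\<in>carrier G. (x \<otimes>\<^bsub>A\<^esub> f) r * \<xi> (t \<otimes> r)) = 0" if t: "t \<in> carrier G" for t
  proof -
    have "(\<Sum>\<^sub>\<infinity>r\<in>carrier G. (x \<otimes>\<^bsub>A\<^esub> f) r * \<xi> (t \<otimes> r))
        = (\<Sum>\<^sub>\<infinity>s\<in>carrier G. x s * (\<Sum>\<^sub>\<infinity>r\<in>carrier G. f r * \<xi> (t \<otimes> (s \<otimes> r))))"
      by (rule pairing_mult[OF 4(2) _ dominated_shift[OF dominated_xi t]]) (use 4 in \<open>simp add: J_def\<close>)
    also have "\<dots> = (\<Sum>\<^sub>\<infinity>s\<in>carrier G. x s * (\<Sum>\<^sub>\<infinity>r\<in>carrier G. f r * \<xi> ((t \<otimes> s) \<otimes> r)))"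
      using t by (simp add: m_assoc cong: infsum_cong)
    also have "\<dots> = (\<Sum>\<^sub>\<infinity>s\<in>carrier G. 0)"
      using 4 t by (intro infsum_cong) (simp add: J_def)
    finally show ?thesis by simp
  qed
  then show ?case using 4 by (simp add: J_def)
qed (auto simp: J_def, simp add: A_zero)

definition \<delta> :: "'a \<Rightarrow> 'a \<Rightarrow> complex" where
  "\<delta> t = (\<lambda>s. if s = t then 1 else 0)"

lemma delta_closed: "t \<in> carrier G \<Longrightarrow> \<delta> t \<in> carrier A"
  by (rule mem_A_finite_support) (auto simp: \<delta>_def)

lemma inj_delta: "inj \<delta>"
  by (rule injI) (metis \<delta>_def zero_neq_one)

lemma comb_delta:
  assumes "finite S" "S \<subseteq> carrier G"
  shows "A.comb c (\<delta> ` S) = (\<lambda>s. if s \<in> S then c (\<delta> s) else 0)"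
  using assms
proof (induction rule: finite_induct)
  case empty show ?case by (simp add: A.comb_def A_zero)
next
  case (insert t S)
  have "A.comb c (\<delta> ` insert t S) = c (\<delta> t) \<odot>\<^bsub>A\<^esub> \<delta> t \<oplus>\<^bsub>A\<^esub> A.comb c (\<delta> ` S)"
    unfolding image_insert using insert inj_delta
    by (intro A.comb_insert) (auto intro!: delta_closed dest: injD)
  also have "\<dots> = (\<lambda>s. if s \<in> insert t S then c (\<delta> s) else 0)"
    using insert by (auto simp: A_add A_smult \<delta>_def)
  finally show ?case .
qed

text \<open>Subtracting from \<open>a\<close> a suitable multiple of the point mass at each \<open>t \<in> T\<close> makes all the coset sums vanish, because
every coset contains exactly one of these points.\<close>
lemma finite_codimension_J: "finite_codimension J A"
proof -
  have "\<exists>c. \<exists>i\<in>J. a = i \<oplus>\<^bsub>A\<^esub> A.comb c (\<delta> ` T)" if a: "a \<in> carrier A" for a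
  proof -
    define y where "y t = (\<Sum>\<^sub>\<infinity>r\<in>carrier G. a r * \<xi> (inv t \<otimes> r))" for t
    define c where "c f = y (inv_into UNIV \<delta> f)" for f
    define p where "p = A.comb c (\<delta> ` T)"
    have p: "p = (\<lambda>s. if s \<in> T then y s else 0)"
      unfolding p_def comb_delta[OF T] c_def by (rule ext) (simp add: inv_into_f_f[OF inj_delta])
    have pA: "p \<in> carrier A" unfolding p_def using T(2) by (intro A.comb_closed) (auto intro: delta_closed)
    define i where "i = a \<oplus>\<^bsub>A\<^esub> (- 1) \<odot>\<^bsub>A\<^esub> p"
    have iA: "i \<in> carrier A" unfolding i_def using a pA by simp
    have "(\<Sum>\<^sub>\<infinity>r\<in>carrier G. i r * \<xi> (g \<otimes> r)) = 0" if g: "g \<in> carrier G" for g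
    proof -
      obtain t where t: "t \<in> T" "g \<otimes> t \<in> H" and uniq: "\<And>s. s \<in> T \<Longrightarrow> g \<otimes> s \<in> H \<Longrightarrow> s = t"
        using transversal[OF g] by blast
      have tG: "t \<in> carrier G" using t T by blast
      have "(\<Sum>\<^sub>\<infinity>r\<in>carrier G. i r * \<xi> (g \<otimes> r))
          = (\<Sum>\<^sub>\<infinity>r\<in>carrier G. a r * \<xi> (g \<otimes> r)) - (\<Sum>\<^sub>\<infinity>r\<in>carrier G. p r * \<xi> (g \<otimes> r))"
        unfolding i_def A_add A_smult using a pA g
        by (simp add: distrib_right diff_conv_add_uminus infsum_add infsum_uminus summable_on_uminus J_summable
            del: add_uminus_conv_diff)
      also have "(\<Sum>\<^sub>\<infinity>r\<in>carrier G. p r * \<xi> (g \<otimes> r)) = p t * \<xi> (g \<otimes> t)"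
        by (rule infsum_single[OF tG]) (use uniq in \<open>auto simp: p xi_def\<close>)
      also have "\<dots> = of_real (\<chi> (g \<otimes> t)) * y t" using t by (simp add: p xi_def)
      also have "\<dots> = (\<Sum>\<^sub>\<infinity>r\<in>carrier G. of_real (\<chi> (g \<otimes> t)) * (a r * \<xi> (inv t \<otimes> r)))"
        unfolding y_def by (rule infsum_cmult_right'[symmetric])
      also have "\<dots> = (\<Sum>\<^sub>\<infinity>r\<in>carrier G. a r * \<xi> (g \<otimes> r))"
      proof (rule infsum_cong)
        fix r assume r: "r \<in> carrier G"
        have "g \<otimes> r = (g \<otimes> t) \<otimes> (inv t \<otimes> r)" using g r tG by (metis inv_closed l_one m_assoc m_closed r_inv)
        then show "of_real (\<chi> (g \<otimes> t)) * (a r * \<xi> (inv t \<otimes> r)) = a r * \<xi> (g \<otimes> r)"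
          using xi_mult[OF t(2), of "inv t \<otimes> r"] r tG by simp
      qed
      finally show ?thesis by simp
    qed
    then have "i \<in> J" using iA by (simp add: J_def)
    moreover have "a = i \<oplus>\<^bsub>A\<^esub> p" unfolding i_def by (simp add: A_add A_smult)
    ultimately show ?thesis unfolding p_def by blast
  qed
  then have "A.spans_mod J (\<delta> ` T)" using T by (auto simp: A.spans_mod_def intro: delta_closed)
  then show ?thesis unfolding A.finite_codimension_iff by blast
qed

end

section \<open>Two facts about summable families\<close>

text \<open>A summable family stays summable after multiplication with a factor that tends to infinity slowly. With finite
sets \<open>F j\<close> outside of which \<open>b\<close> has sum at most \<open>1 / 2 ^ j\<close>, the factor is one more than
the number of \<open>j\<close> with \<open>x \<notin> F j\<close>. The
sublevel sets are only finite within the support of \<open>b\<close>, since \<open>S\<close> may be uncountable.\<close>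
lemma slow_weight_exists:
  fixes b :: "'a \<Rightarrow> real"
  assumes b: "b summable_on S" and nonneg: "\<And>x. x \<in> S \<Longrightarrow> 0 \<le> b x"
  obtains \<eta> :: "'a \<Rightarrow> real" where "\<And>x. 1 \<le> \<eta> x" "(\<lambda>x. b x * \<eta> x) summable_on S"
    "\<And>C. finite {x \<in> S. b x \<noteq> 0 \<and> \<eta> x \<le> C}"
proof -
  have "\<exists>F. finite F \<and> F \<subseteq> S \<and> (\<forall>E. finite E \<longrightarrow> E \<subseteq> S - F \<longrightarrow> sum b E \<le> (1/2) ^ j)" for j :: nat
  proof -
    obtain F where F: "finite F" "F \<subseteq> S" "dist (sum b F) (infsum b S) \<le> (1/2) ^ j"
      using infsum_finite_approximation[OF b, of "(1/2) ^ j"] by auto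
    have "sum b E \<le> (1/2) ^ j" if E: "finite E" "E \<subseteq> S - F" for E
    proof -
      have "sum b F + sum b E = sum b (F \<union> E)" using E F by (intro sum.union_disjoint[symmetric]) auto
      also have "\<dots> \<le> infsum b S" using E F nonneg by (intro finite_sum_le_infsum[OF b]) auto
      finally show ?thesis using F(3) by (simp add: dist_real_def)
    qed
    then show ?thesis using F by blast
  qed
  then obtain F where F: "\<And>j :: nat. finite (F j)" "\<And>j. F j \<subseteq> S"
    and tail: "\<And>j E. finite E \<Longrightarrow> E \<subseteq> S - F j \<Longrightarrow> sum b E \<le> (1/2) ^ j" by metis
  define N where "N x = {j. x \<notin> F j}" for x
  define \<eta> where "\<eta> x = 1 + real (card (N x))" for x
  have fin: "finite (N x)" if x: "x \<in> S" "b x \<noteq> 0" for x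
  proof -
    have "0 < b x" using x nonneg by (simp add: less_le)
    then obtain m where m: "(1/2) ^ m < b x" using real_arch_pow_inv[of "b x" "1/2"] by auto
    have "j < m" if "j \<in> N x" for j
    proof (rule ccontr)
      assume "\<not> j < m"
      then have "(1/2 :: real) ^ j \<le> (1/2) ^ m" by (intro power_decreasing) auto
      moreover have "b x \<le> (1/2) ^ j" using tail[of "{x}" j] x that by (simp add: N_def)
      ultimately show False using m by linarith
    qed
    then have "N x \<subseteq> {..<m}" by auto
    then show ?thesis by (rule finite_subset) simp
  qed
  show thesis
  proof
    show "1 \<le> \<eta> x" for x by (simp add: \<eta>_def)
    show "finite {x \<in> S. b x \<noteq> 0 \<and> \<eta> x \<le> C}" for C
    proof -
      obtain m :: nat where m: "C \<le> real m" using real_arch_simple by blast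
      have "{x \<in> S. b x \<noteq> 0 \<and> \<eta> x \<le> C} \<subseteq> (\<Union>j\<le>m. F j)"
      proof (rule ccontr)
        assume "\<not> ?thesis"
        then obtain x where x: "x \<in> S" "b x \<noteq> 0" "\<eta> x \<le> C" "\<And>j. j \<le> m \<Longrightarrow> x \<notin> F j" by auto
        have "card {..m} \<le> card (N x)" using x fin by (intro card_mono) (auto simp: N_def)
        then show False using x m by (simp add: \<eta>_def)
      qed
      then show ?thesis by (rule finite_subset) (simp add: F)
    qed
    show "(\<lambda>x. b x * \<eta> x) summable_on S"
    proof (rule nonneg_bdd_above_summable_on)
      show "0 \<le> b x * \<eta> x" if "x \<in> S" for x using nonneg[OF that] by (simp add: \<eta>_def)
      have "(\<Sum>x\<in>E. b x * \<eta> x) \<le> infsum b S + 2" if E: "finite E" "E \<subseteq> S" for E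
      proof -
        define E' where "E' = {x \<in> E. b x \<noteq> 0}"
        have "finite (\<Union>x\<in>E'. N x)" using E fin by (auto simp: E'_def)
        then obtain m where m: "(\<Union>x\<in>E'. N x) \<subseteq> {..<m}" using finite_nat_bounded by blast
        have "(\<Sum>x\<in>E. b x * \<eta> x) = (\<Sum>x\<in>E. b x) + (\<Sum>x\<in>E. b x * card (N x))"
          by (simp add: \<eta>_def distrib_left sum.distrib)
        also have "(\<Sum>x\<in>E. b x) \<le> infsum b S" using E nonneg by (intro finite_sum_le_infsum[OF b]) auto
        also have "(\<Sum>x\<in>E. b x * card (N x)) = (\<Sum>x\<in>E'. b x * card (N x))"
          unfolding E'_def using E by (intro sum.mono_neutral_right) auto
        also have "\<dots> = (\<Sum>x\<in>E'. \<Sum>j<m. if x \<notin> F j then b x else 0)"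
        proof (rule sum.cong)
          fix x assume x: "x \<in> E'"
          have "(\<Sum>j<m. if x \<notin> F j then b x else 0) = (\<Sum>j\<in>N x. b x)"
            using m x by (intro sum.mono_neutral_cong_right) (auto simp: N_def)
          then show "b x * card (N x) = (\<Sum>j<m. if x \<notin> F j then b x else 0)" by simp
        qed simp
        also have "\<dots> = (\<Sum>j<m. \<Sum>x\<in>E'. if x \<notin> F j then b x else 0)" by (rule sum.swap)
        also have "\<dots> \<le> (\<Sum>j<m. (1/2) ^ j)"
        proof (rule sum_mono)
          fix j
          have "finite E'" using E by (simp add: E'_def)
          then have "(\<Sum>x\<in>E'. if x \<notin> F j then b x else 0) = (\<Sum>x\<in>E' - F j. b x)"
            by (intro sum.mono_neutral_cong_right) auto
          also have "\<dots> \<le> (1/2) ^ j" using E by (intro tail) (auto simp: E'_def)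
          finally show "(\<Sum>x\<in>E'. if x \<notin> F j then b x else 0) \<le> (1/2) ^ j" .
        qed
        also have "\<dots> \<le> 2"
          using sum_gp_strict[of "1/2 :: real" m] by simp
        finally show ?thesis by simp
      qed
      then show "bdd_above (sum (\<lambda>x. b x * \<eta> x) ` {F. F \<subseteq> S \<and> finite F})" by (intro bdd_aboveI2) auto
    qed
  qed
qed

text \<open>Duality of \<open>\<ell>\<^sup>1\<close> and \<open>\<ell>\<^sup>\<infinity>\<close>, for upper bounds. Point
masses \<open>\<beta>\<close> give pointwise bounds \<open>K\<close>; if there is no uniform one, choose points \<open>x n\<close> at which the family exceeds
\<open>4 ^ n\<close> and take for \<open>\<beta>\<close> the masses \<open>1 / 2 ^ n\<close>. Points of strictly increasing \<open>K\<close> are distinct, so \<open>\<beta>\<close> is well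
defined.\<close>
lemma uniformly_bounded_if_multipliers:
  fixes q :: "'i \<Rightarrow> 'a \<Rightarrow> real"
  assumes bdd: "\<And>\<beta>. \<beta> summable_on S \<Longrightarrow> (\<And>x. 0 \<le> \<beta> x) \<Longrightarrow> \<exists>K. \<forall>i. \<forall>x\<in>S. \<beta> x * q i x \<le> K"
  shows "\<exists>C. \<forall>i. \<forall>x\<in>S. q i x \<le> C"
proof (rule ccontr)
  assume "\<not> ?thesis"
  then have big: "\<exists>i. \<exists>x\<in>S. C < q i x" for C by (meson not_le)
  have "\<exists>K. \<forall>i. q i x \<le> K" if x: "x \<in> S" for x
  proof -
    have "(\<lambda>y. if y = x then 1 else 0 :: real) summable_on S"
      by (rule finite_nonzero_values_imp_summable_on) (rule finite_subset[of _ "{x}"], auto)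
    then have "\<exists>K. \<forall>i. \<forall>y\<in>S. (if y = x then 1 else 0) * q i y \<le> K"
      by (rule bdd) simp
    then obtain K where K: "\<forall>i. \<forall>y\<in>S. (if y = x then 1 else 0) * q i y \<le> K" ..
    have "q i x \<le> K" for i using K[rule_format, OF x, of i] by simp
    then show ?thesis by blast
  qed
  then obtain K where K: "\<And>x i. x \<in> S \<Longrightarrow> q i x \<le> K x" by metis
  have "\<exists>x. \<forall>n. (x n \<in> S \<and> (\<exists>i. 4 ^ n < q i (x n))) \<and> K (x n) < K (x (Suc n))"
  proof (rule dependent_nat_choice)
    show "\<exists>x. x \<in> S \<and> (\<exists>i. 4 ^ 0 < q i x)" using big[of "4 ^ 0"] by blast
    fix x and n :: nat
    obtain i y where y: "y \<in> S" "max (4 ^ Suc n) (K x) < q i y" using big[of "max (4 ^ Suc n) (K x)"] by blast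
    then have "K x < K y" using K[OF y(1), of i] by simp
    then show "\<exists>y. (y \<in> S \<and> (\<exists>i. 4 ^ Suc n < q i y)) \<and> K x < K y"
      using y by auto
  qed
  then obtain x where x: "\<And>n. x n \<in> S" "\<And>n :: nat. \<exists>i. 4 ^ n < q i (x n)" "\<And>n. K (x n) < K (x (Suc n))"
    by blast
  have "strict_mono (\<lambda>n. K (x n))" using x(3) by (simp add: strict_mono_Suc_iff)
  then have "inj (\<lambda>n. K (x n))" by (rule strict_mono_imp_inj_on)
  then have inj: "inj x" by (auto simp: inj_def)
  define \<beta> where "\<beta> y = (if y \<in> range x then (1/2) ^ (inv_into UNIV x y) else 0 :: real)" for y
  have \<beta>x: "\<beta> (x n) = (1/2) ^ n" for n using inj by (simp add: \<beta>_def)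
  have "(\<lambda>n. (1/2 :: real) ^ n) summable_on UNIV"
    by (rule norm_summable_imp_summable_on) (simp add: norm_power summable_geometric)
  then have "\<beta> summable_on range x" using inj by (subst summable_on_reindex) (simp_all add: o_def \<beta>x)
  moreover have "\<beta> summable_on range x \<longleftrightarrow> \<beta> summable_on S"
    using x(1) by (intro summable_on_cong_neutral) (auto simp: \<beta>_def)
  ultimately have "\<beta> summable_on S" by simp
  moreover have "0 \<le> \<beta> y" for y by (simp add: \<beta>_def)
  ultimately obtain B where B: "\<forall>i. \<forall>y\<in>S. \<beta> y * q i y \<le> B" using bdd[of \<beta>] by blast
  obtain n where n: "B < 2 ^ n" using real_arch_pow[of 2 B] by auto
  obtain i where i: "4 ^ n < q i (x n)" using x(2) by blast
  have "(2 :: real) ^ n = (1/2) ^ n * 4 ^ n" by (simp flip: power_mult_distrib)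
  also have "\<dots> \<le> \<beta> (x n) * q i (x n)" unfolding \<beta>x using i by (intro mult_left_mono) auto
  also have "\<dots> \<le> B" using B x(1) by blast
  finally show False using n by simp
qed


section \<open>The path metric\<close>

context group begin

inductive word_of_length :: "'a set \<Rightarrow> nat \<Rightarrow> 'a \<Rightarrow> bool" for L where
  empty: "word_of_length L 0 \<one>"
| step: "word_of_length L n g \<Longrightarrow> l \<in> L \<Longrightarrow> word_of_length L (Suc n) (g \<otimes> l)"
| step_inv: "word_of_length L n g \<Longrightarrow> l \<in> L \<Longrightarrow> word_of_length L (Suc n) (g \<otimes> inv l)"

text \<open>\<open>reachable w e L g r\<close>: there is a path of length \<open>r\<close> from the identity to \<open>g\<close>, where the edge between \<open>g\<close> and
\<open>g \<otimes> l\<close> has length \<open>w g * e l\<close> in both directions.\<close>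
inductive reachable :: "('a \<Rightarrow> real) \<Rightarrow> ('a \<Rightarrow> real) \<Rightarrow> 'a set \<Rightarrow> 'a \<Rightarrow> real \<Rightarrow> bool" for w e L where
  start: "reachable w e L \<one> 0"
| forward: "reachable w e L g r \<Longrightarrow> l \<in> L \<Longrightarrow> reachable w e L (g \<otimes> l) (r + w g * e l)"
| backward: "reachable w e L (g \<otimes> l) r \<Longrightarrow> g \<in> carrier G \<Longrightarrow> l \<in> L \<Longrightarrow> reachable w e L g (r + w g * e l)"

end

locale path_metric = group +
  fixes H :: "'a set" and w \<eta> :: "'a \<Rightarrow> real" and L :: "'a set"
  assumes H: "subgroup H G" and L: "L \<subseteq> H"
    and w1: "h \<in> H \<Longrightarrow> 1 \<le> w h" and w_mult: "h \<in> H \<Longrightarrow> k \<in> H \<Longrightarrow> w (h \<otimes> k) \<le> w h * w k"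
    and \<eta>1: "1 \<le> \<eta> l"
begin

abbreviation reach where "reach \<equiv> reachable w (\<lambda>l. w l * \<eta> l) L"

text \<open>The distance from the identity, cut off at \<open>R\<close>. The bound makes the associated functional bounded, and gives a value
also to points that no path reaches.\<close>
definition dist_upto :: "real \<Rightarrow> 'a \<Rightarrow> real" where
  "dist_upto R h = Inf (insert R {r. reach h r})"

lemma in_carrier: "h \<in> H \<Longrightarrow> h \<in> carrier G"
  using subgroup.mem_carrier[OF H] .

lemma edge_pos: "h \<in> H \<Longrightarrow> l \<in> L \<Longrightarrow> w h \<le> w h * (w l * \<eta> l)"
proof -
  assume *: "h \<in> H" "l \<in> L"
  then have "1 * 1 \<le> w l * \<eta> l" using w1[of l] \<eta>1[of l] L by (intro mult_mono) auto
  then show ?thesis using mult_left_mono[of 1 "w l * \<eta> l" "w h"] w1[OF *(1)] by simp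
qed

lemma mem_H_if_edge: "g \<otimes> l \<in> H \<Longrightarrow> g \<in> carrier G \<Longrightarrow> l \<in> L \<Longrightarrow> g \<in> H"
proof -
  assume *: "g \<otimes> l \<in> H" "g \<in> carrier G" "l \<in> L"
  then have l: "l \<in> H" using L by auto
  have "(g \<otimes> l) \<otimes> inv l \<in> H" using *(1) l H by (simp add: subgroup.m_closed subgroup.m_inv_closed)
  then show ?thesis using * in_carrier[OF l] by (simp add: m_assoc)
qed

lemma reach_H: "reach h r \<Longrightarrow> h \<in> H \<and> 0 \<le> r"
proof (induction rule: reachable.induct)
  case start show ?case using H by (simp add: subgroup.one_closed)
next
  case (forward g r l)
  then show ?case using edge_pos[of g l] w1[of g] L subgroup.m_closed[OF H, of g l] by auto
next
  case (backward g l r)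
  then show ?case using edge_pos[of g l] w1[of g] mem_H_if_edge[of g l] by auto
qed

text \<open>The length of an edge is at least \<open>w h * \<eta> l\<close> at either of its end points \<open>h\<close>: at the far end \<open>p \<otimes> l\<close> by
submultiplicativity of \<open>w\<close>, at the near end because \<open>w l \<ge> 1\<close>.\<close>
lemma last_edge:
  assumes "reach h r" "h \<noteq> \<one>"
  shows "\<exists>p r' l. reach p r' \<and> l \<in> L \<and> (h = p \<otimes> l \<or> h = p \<otimes> inv l) \<and> r' + w h * \<eta> l \<le> r"
  using assms(1)
proof cases
  case start then show ?thesis using assms(2) by simp
next
  case (forward p r' l)
  have p: "p \<in> H" using reach_H forward by blast
  have "w h * \<eta> l \<le> (w p * w l) * \<eta> l"
    using w_mult[OF p, of l] forward L \<eta>1[of l] by (intro mult_right_mono) auto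
  then show ?thesis using forward by (intro exI[of _ p] exI[of _ r'] exI[of _ l]) (auto simp: mult_ac)
next
  case (backward l r')
  have h: "h \<in> H" using reach_H assms(1) by blast
  have l: "l \<in> H" "l \<in> carrier G" using backward L in_carrier by auto
  have "w h * \<eta> l \<le> w h * (w l * \<eta> l)"
    using w1[OF h] w1[OF l(1)] \<eta>1[of l] by (intro mult_left_mono) (auto simp: mult_le_cancel_right2)
  moreover have "h = (h \<otimes> l) \<otimes> inv l" using backward l by (simp add: m_assoc)
  ultimately show ?thesis using backward
    by (intro exI[of _ "h \<otimes> l"] exI[of _ r'] exI[of _ l]) auto
qed

lemma dist_set_bdd: "0 \<le> R \<Longrightarrow> bdd_below (insert R {r. reach h r})"
  using reach_H by (intro bdd_belowI[of _ 0]) auto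

lemma dist_upto_bounds:
  assumes "0 \<le> R"
  shows "0 \<le> dist_upto R h" "dist_upto R h \<le> R"
  unfolding dist_upto_def using assms reach_H
  by (auto intro!: cInf_greatest cInf_lower[OF _ dist_set_bdd])

lemma dist_upto_one: "0 \<le> R \<Longrightarrow> dist_upto R \<one> = 0"
  using cInf_lower[OF _ dist_set_bdd, of 0 R \<one>] dist_upto_bounds(1)[of R \<one>] reachable.start[of w "\<lambda>l. w l * \<eta> l" L]
  by (simp add: dist_upto_def)

lemma dist_upto_step:
  assumes R: "0 \<le> R" and c: "0 \<le> c" and step: "\<And>r. reach g r \<Longrightarrow> reach h (r + c)"
  shows "dist_upto R h \<le> dist_upto R g + c"
proof -
  have "dist_upto R h - c \<le> dist_upto R g"
    unfolding dist_upto_def[of R g]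
  proof (rule cInf_greatest)
    fix r assume "r \<in> insert R {r. reach g r}"
    then consider "r = R" | "reach g r" by blast
    then show "dist_upto R h - c \<le> r"
    proof cases
      case 1 then show ?thesis using dist_upto_bounds(2)[OF R, of h] c by simp
    next
      case 2
      then have "r + c \<in> insert R {r. reach h r}" using step by simp
      from cInf_lower[OF this dist_set_bdd[OF R]] show ?thesis by (simp add: dist_upto_def)
    qed
  qed simp
  then show ?thesis by simp
qed

lemma dist_upto_Lipschitz:
  assumes "0 \<le> R" "h \<in> H" "l \<in> L"
  shows "\<bar>dist_upto R (h \<otimes> l) - dist_upto R h\<bar> \<le> w h * (w l * \<eta> l)"
proof -
  have c: "0 \<le> w h * (w l * \<eta> l)" using edge_pos[OF assms(2,3)] w1[OF assms(2)] by simp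
  have "reach (h \<otimes> l) (r + w h * (w l * \<eta> l))" if "reach h r" for r
    using reachable.forward[OF that assms(3)] by simp
  then have "dist_upto R (h \<otimes> l) \<le> dist_upto R h + w h * (w l * \<eta> l)"
    by (rule dist_upto_step[OF assms(1) c])
  moreover have "reach h (r + w h * (w l * \<eta> l))" if "reach (h \<otimes> l) r" for r
    using reachable.backward[OF that in_carrier[OF assms(2)] assms(3)] by simp
  then have "dist_upto R h \<le> dist_upto R (h \<otimes> l) + w h * (w l * \<eta> l)"
    by (rule dist_upto_step[OF assms(1) c])
  ultimately show ?thesis by simp
qed

text \<open>The hypothesis yields, for every \<open>h\<close>, a path to \<open>h\<close> of length at most \<open>(C + 1) * w h\<close>. Its last edge is at least
\<open>w h * \<eta> l\<close> long, hence \<open>\<eta> l \<le> C + 1\<close>, and at least a fraction \<open>1 / (C + 1)\<close> of the path, hence the rest is shorter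
by the factor \<open>a\<close>. Repeating this from the predecessor of \<open>h\<close>, with a good path to the predecessor, reaches the
identity after \<open>n\<close> steps and gives \<open>a ^ n\<close> up to constants as a lower bound of the original length.\<close>
lemma exponential_growth:
  assumes C: "1 \<le> C" and bound: "\<And>R h. h \<in> H \<Longrightarrow> dist_upto (real R) h \<le> C * w h"
  defines "a \<equiv> (C + 1) / C"
  assumes h: "h \<in> H"
  shows "\<exists>n. word_of_length {l \<in> L. \<eta> l \<le> C + 1} n h \<and> 1 / (a * (C + 1)) * a ^ n \<le> w h"
proof -
  let ?L = "{l \<in> L. \<eta> l \<le> C + 1}"
  have a: "1 < a" unfolding a_def using C by (simp add: field_simps)
  have short: "\<exists>r. reach h r \<and> r \<le> (C + 1) * w h" if h: "h \<in> H" for h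
  proof -
    obtain R :: nat where R: "(C + 1) * w h \<le> R" using real_arch_simple by blast
    have "dist_upto (real R) h < (C + 1) * w h"
      using bound[OF h, of R] w1[OF h] by (simp add: distrib_right)
    then obtain r where r: "r \<in> insert (real R) {r. reach h r}" "r < (C + 1) * w h"
      unfolding dist_upto_def using cInf_lessD[of "insert (real R) {r. reach h r}"] by auto
    then show ?thesis using R by (intro exI[of _ r]) auto
  qed
  \<comment> \<open>Every edge has length at least 1, so the integer part of the length decreases along the induction.\<close>
  have main: "\<exists>n. word_of_length ?L n h \<and> (h = \<one> \<or> a ^ n \<le> a * r)" if "reach h r" for h r
    using that
  proof (induction "nat \<lfloor>r\<rfloor>" arbitrary: h r rule: less_induct)
    case less
    show ?case
    proof (cases "h = \<one>")
      case True
      then show ?thesis using word_of_length.empty[of ?L] by auto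
    next
      case False
      have h: "h \<in> H" using reach_H less.prems by blast
      have "\<exists>s. reach h s \<and> s \<le> r \<and> s \<le> (C + 1) * w h"
        using short[OF h] less.prems by (metis linear order_trans)
      then obtain s where s: "reach h s" "s \<le> r" "s \<le> (C + 1) * w h" by blast
      obtain p r' l where p: "reach p r'" "l \<in> L" "h = p \<otimes> l \<or> h = p \<otimes> inv l" "r' + w h * \<eta> l \<le> s"
        using last_edge[OF s(1) False] by blast
      have r': "0 \<le> r'" using reach_H p(1) by blast
      have wh: "w h \<le> w h * \<eta> l" using w1[OF h] \<eta>1[of l] by (simp add: mult_le_cancel_left1)
      have "w h * \<eta> l \<le> w h * (C + 1)" using p(4) s(3) r' by (simp add: mult.commute)
      then have l: "l \<in> ?L" using w1[OF h] p(2) by (simp add: mult_le_cancel_left)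
      have word: "word_of_length ?L (Suc n) h" if "word_of_length ?L n p" for n
        using p(3) word_of_length.step[OF that l] word_of_length.step_inv[OF that l] by auto
      have "s / (C + 1) \<le> w h" using s(3) C by (simp add: divide_le_eq mult.commute)
      then have "r' \<le> s - s / (C + 1)" using p(4) wh by simp
      also have "\<dots> = s / a" unfolding a_def using C by (simp add: field_simps)
      finally have ar': "a * r' \<le> r" using a s(2) by (simp add: field_simps)
      have r1: "r' + 1 \<le> r" using p(4) wh w1[OF h] s(2) by linarith
      then have "\<lfloor>r'\<rfloor> + 1 \<le> \<lfloor>r\<rfloor>" by linarith
      then have "nat \<lfloor>r'\<rfloor> < nat \<lfloor>r\<rfloor>" using r' by linarith
      from less.hyps[OF this p(1)]
      obtain n where n: "word_of_length ?L n p" "p = \<one> \<or> a ^ n \<le> a * r'" by blast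
      show ?thesis
      proof (cases "p = \<one>")
        case True
        then have "word_of_length ?L (Suc 0) h" using word word_of_length.empty[of ?L] by blast
        moreover have "a ^ Suc 0 \<le> a * r" using a r1 r' by simp
        ultimately show ?thesis by blast
      next
        case False
        then have "a ^ Suc n \<le> a * (a * r')" using n a by simp
        also have "\<dots> \<le> a * r" using a ar' by (intro mult_left_mono) auto
        finally show ?thesis using word[OF n(1)] by blast
      qed
    qed
  qed
  obtain r where r: "reach h r" "r \<le> (C + 1) * w h" using short[OF h] by blast
  obtain n where n: "word_of_length ?L n h" "h = \<one> \<or> a ^ n \<le> a * r" using main[OF r(1)] by blast
  show ?thesis
  proof (cases "h = \<one>")
    case True
    have "1 \<le> a * (C + 1)" using a C mult_mono[of 1 a 1 "C + 1"] by simp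
    then have "1 / (a * (C + 1)) * a ^ 0 \<le> w h" using w1[OF h] by (simp add: divide_le_eq_1 order_trans[of _ 1])
    then show ?thesis using True word_of_length.empty[of ?L] by blast
  next
    case False
    then have "a ^ n \<le> a * ((C + 1) * w h)"
      using n r(2) a by (meson less_le_trans mult_left_mono order_trans less_imp_le zero_less_one)
    then have "1 / (a * (C + 1)) * a ^ n \<le> w h" using a C by (simp add: divide_le_eq mult_ac)
    then show ?thesis using n(1) by blast
  qed
qed

end

section \<open>Finite generation forces exponential growth\<close>

context beurling_character begin

text \<open>The elements whose pairing with the translate of \<open>u R\<close> by \<open>s\<close> is at most \<open>K * \<omega> s\<close>, with \<open>K\<close> independent of \<open>R\<close>
and \<open>s\<close>. This is a left ideal, so it is enough to look at generators.\<close>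
definition bounded_against :: "(real \<Rightarrow> 'a \<Rightarrow> complex) \<Rightarrow> ('a \<Rightarrow> complex) set" where
  "bounded_against u = {f \<in> carrier A. \<exists>K. \<forall>R\<ge>0. dominated (\<lambda>s. \<Sum>\<^sub>\<infinity>r\<in>carrier G. f r * u R (s \<otimes> r)) K}"

lemma left_ideal_bounded_against:
  assumes u: "\<And>R. 0 \<le> R \<Longrightarrow> \<exists>K. dominated (u R) K"
  shows "left_ideal (bounded_against u) A"
proof (rule A.left_idealI, goal_cases)
  case 1 show ?case by (auto simp: bounded_against_def)
next
  case 2
  have "dominated (\<lambda>s. \<Sum>\<^sub>\<infinity>r\<in>carrier G. \<zero>\<^bsub>A\<^esub> r * u R (s \<otimes> r)) 0" for R
    by (simp add: dominated_def A_zero)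
  then show ?case using A.zero_closed unfolding bounded_against_def by blast
next
  case (3 f g)
  then obtain K K' where fA: "f \<in> carrier A" and gA: "g \<in> carrier A"
    and K: "\<And>R. 0 \<le> R \<Longrightarrow> dominated (\<lambda>s. \<Sum>\<^sub>\<infinity>r\<in>carrier G. f r * u R (s \<otimes> r)) K"
    and K': "\<And>R. 0 \<le> R \<Longrightarrow> dominated (\<lambda>s. \<Sum>\<^sub>\<infinity>r\<in>carrier G. g r * u R (s \<otimes> r)) K'"
    by (auto simp: bounded_against_def)
  have "dominated (\<lambda>s. \<Sum>\<^sub>\<infinity>r\<in>carrier G. (f \<oplus>\<^bsub>A\<^esub> g) r * u R (s \<otimes> r)) (K + K')" if R: "0 \<le> R" for R
    unfolding dominated_def
  proof
    fix s assume s: "s \<in> carrier G"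
    obtain C where C: "dominated (u R) C" using u[OF R] by blast
    have "(\<Sum>\<^sub>\<infinity>r\<in>carrier G. (f \<oplus>\<^bsub>A\<^esub> g) r * u R (s \<otimes> r))
      = (\<Sum>\<^sub>\<infinity>r\<in>carrier G. f r * u R (s \<otimes> r)) + (\<Sum>\<^sub>\<infinity>r\<in>carrier G. g r * u R (s \<otimes> r))"
      using pairing_summable[OF fA dominated_shift[OF C s]] pairing_summable[OF gA dominated_shift[OF C s]]
      by (simp add: A_add distrib_right infsum_add)
    also have "cmod \<dots> \<le> K * \<omega> s + K' * \<omega> s"
      using K[OF R] K'[OF R] s by (intro norm_triangle_mono) (auto simp: dominated_def)
    finally show "cmod (\<Sum>\<^sub>\<infinity>r\<in>carrier G. (f \<oplus>\<^bsub>A\<^esub> g) r * u R (s \<otimes> r)) \<le> (K + K') * \<omega> s"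
      by (simp add: distrib_right)
  qed
  then show ?case using fA gA A.a_closed unfolding bounded_against_def by blast
next
  case (4 f x)
  then obtain K where fA: "f \<in> carrier A" 
    and K: "\<And>R. 0 \<le> R \<Longrightarrow> dominated (\<lambda>s. \<Sum>\<^sub>\<infinity>r\<in>carrier G. f r * u R (s \<otimes> r)) K"
    by (auto simp: bounded_against_def)
  define M where "M = (\<Sum>\<^sub>\<infinity>p\<in>carrier G. cmod (x p) * \<omega> p)"
  have "dominated (\<lambda>s. \<Sum>\<^sub>\<infinity>r\<in>carrier G. (x \<otimes>\<^bsub>A\<^esub> f) r * u R (s \<otimes> r)) (K * M)" if R: "0 \<le> R" for R
    unfolding dominated_def
  proof
    fix s assume s: "s \<in> carrier G"
    obtain C where C: "dominated (u R) C" using u[OF R] by blast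
    let ?v = "\<lambda>s. \<Sum>\<^sub>\<infinity>r\<in>carrier G. f r * u R (s \<otimes> r)"
    have "(\<Sum>\<^sub>\<infinity>r\<in>carrier G. (x \<otimes>\<^bsub>A\<^esub> f) r * u R (s \<otimes> r))
      = (\<Sum>\<^sub>\<infinity>p\<in>carrier G. x p * (\<Sum>\<^sub>\<infinity>r\<in>carrier G. f r * u R (s \<otimes> (p \<otimes> r))))"
      by (rule pairing_mult[OF 4(2) fA dominated_shift[OF C s]])
    also have "\<dots> = (\<Sum>\<^sub>\<infinity>p\<in>carrier G. x p * ?v (s \<otimes> p))"
      using s by (simp add: m_assoc cong: infsum_cong)
    also have "cmod \<dots> \<le> (\<Sum>\<^sub>\<infinity>p\<in>carrier G. (K * \<omega> s) * (cmod (x p) * \<omega> p))"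
    proof (rule norm_infsum_le[OF has_sum_infsum has_sum_infsum])
      show "(\<lambda>p. x p * ?v (s \<otimes> p)) summable_on carrier G" 
        by (rule pairing_summable[OF 4(2) dominated_shift[OF K[OF R] s]])
      show "(\<lambda>p. (K * \<omega> s) * (cmod (x p) * \<omega> p)) summable_on carrier G"
        by (rule summable_on_cmult_right[OF A_summable[OF 4(2)]])
      show "cmod (x p * ?v (s \<otimes> p)) \<le> (K * \<omega> s) * (cmod (x p) * \<omega> p)" if p: "p \<in> carrier G" for p
      proof -
        have "cmod (?v (s \<otimes> p)) \<le> K * \<omega> s * \<omega> p"
          using dominated_shift[OF K[OF R] s] p by (simp add: dominated_def)
        then have "cmod (x p) * cmod (?v (s \<otimes> p)) \<le> cmod (x p) * (K * \<omega> s * \<omega> p)"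
          by (rule mult_left_mono) simp
        then show ?thesis by (simp add: norm_mult mult_ac)
      qed
    qed
    also have "\<dots> = (K * \<omega> s) * M" unfolding M_def by (rule infsum_cmult_right')
    finally have "cmod (\<Sum>\<^sub>\<infinity>r\<in>carrier G. (x \<otimes>\<^bsub>A\<^esub> f) r * u R (s \<otimes> r)) \<le> (K * \<omega> s) * M" .
    then show "cmod (\<Sum>\<^sub>\<infinity>r\<in>carrier G. (x \<otimes>\<^bsub>A\<^esub> f) r * u R (s \<otimes> r)) \<le> K * M * \<omega> s"
      by (simp add: mult_ac)
  qed
  then show ?case using fA 4(2) A.m_closed unfolding bounded_against_def by blast
qed

lemma summable_translate:
  fixes g :: "'a \<Rightarrow> 'z::{comm_monoid_add,topological_space}"
  assumes t: "t \<in> carrier G" and g: "g summable_on carrier G"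
  shows "(\<lambda>q. g (t \<otimes> q)) summable_on carrier G"
proof -
  have "(\<lambda>q. g (t \<otimes> q)) summable_on carrier G \<longleftrightarrow> g summable_on carrier G"
    by (rule summable_on_reindex_bij_witness[where i = "\<lambda>r. inv t \<otimes> r" and j = "\<lambda>q. t \<otimes> q"])
      (use t in \<open>auto simp: m_assoc[symmetric]\<close>)
  with g show ?thesis by simp
qed

lemma twisted_weight:
  assumes "h \<in> H"
  shows "1 \<le> \<omega> h / \<chi> h" "k \<in> H \<Longrightarrow> \<omega> (h \<otimes> k) / \<chi> (h \<otimes> k) \<le> (\<omega> h / \<chi> h) * (\<omega> k / \<chi> k)"
proof -
  show "1 \<le> \<omega> h / \<chi> h" using assms character_le character_pos by (simp add: le_divide_eq_1)
  assume k: "k \<in> H"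
  have "\<omega> (h \<otimes> k) / (\<chi> h * \<chi> k) \<le> (\<omega> h * \<omega> k) / (\<chi> h * \<chi> k)"
    using assms k weight_mult[of h k] character_pos[of h] character_pos[of k] by (intro divide_right_mono) auto
  then show "\<omega> (h \<otimes> k) / \<chi> (h \<otimes> k) \<le> (\<omega> h / \<chi> h) * (\<omega> k / \<chi> k)"
    using assms k by (simp add: character_mult)
qed

text \<open>Let \<open>f\<close> have the values \<open>\<beta> h / \<omega> h\<close> on \<open>H\<close>, with a correction at the identity that puts it into \<open>J\<close>. The
correction is invisible to functionals that vanish at the identity, and there all terms are nonnegative, so each single
one is a lower bound of the pairing.\<close>
lemma J_test_element:
  fixes \<beta> :: "'a \<Rightarrow> real"
  assumes \<beta>: "\<beta> summable_on H" "\<And>x. 0 \<le> \<beta> x"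
  shows "\<exists>f\<in>J. \<forall>v R. v \<one> = 0 \<longrightarrow> (\<forall>x. 0 \<le> v x \<and> v x \<le> R) \<longrightarrow> (\<forall>h\<in>H.
      \<beta> h * (v h / (\<omega> h / \<chi> h)) \<le> cmod (\<Sum>\<^sub>\<infinity>r\<in>carrier G. f r * (\<xi> r * of_real (v r))))"
proof -
  define g :: "'a \<Rightarrow> complex" where "g r = (if r \<in> H then of_real (\<beta> r / \<omega> r) else 0)" for r
  define \<sigma> where "\<sigma> = (\<Sum>\<^sub>\<infinity>r\<in>carrier G. g r * \<xi> r)"
  define f where "f = g \<oplus>\<^bsub>A\<^esub> (- \<sigma>) \<odot>\<^bsub>A\<^esub> \<one>\<^bsub>A\<^esub>"
  have "(\<lambda>t. cmod (g t) * \<omega> t) summable_on carrier G \<longleftrightarrow> \<beta> summable_on H"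
  proof (rule summable_on_cong_neutral)
    fix x assume "x \<in> carrier G \<inter> H"
    then show "cmod (g x) * \<omega> x = \<beta> x"
      using \<beta>(2)[of x] weight_ge_1[of x] by (simp add: g_def norm_divide)
  qed (auto simp: g_def)
  then have gA: "g \<in> carrier A" using \<beta>(1) by (auto simp: mem_A_iff g_def)
  have fA: "f \<in> carrier A" unfolding f_def using gA by simp
  have f: "f r = g r - (if r = \<one> then \<sigma> else 0)" for r by (simp add: f_def A_add A_smult A_one)
  have split: "(\<Sum>\<^sub>\<infinity>r\<in>carrier G. f r * y r) = (\<Sum>\<^sub>\<infinity>r\<in>carrier G. g r * y r) - \<sigma> * y \<one>"
    if y: "dominated y K" for y K
  proof -
    have "(\<Sum>\<^sub>\<infinity>r\<in>carrier G. f r * y r)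
      = (\<Sum>\<^sub>\<infinity>r\<in>carrier G. g r * y r + (if r = \<one> then - \<sigma> * y \<one> else 0))"
      by (rule infsum_cong) (simp add: f left_diff_distrib)
    also have "\<dots> = (\<Sum>\<^sub>\<infinity>r\<in>carrier G. g r * y r) + (\<Sum>\<^sub>\<infinity>r\<in>carrier G. if r = \<one> then - \<sigma> * y \<one> else 0)"
    proof (rule infsum_add[OF pairing_summable[OF gA y]])
      show "(\<lambda>r. if r = \<one> then - \<sigma> * y \<one> else 0) summable_on carrier G"
        by (rule finite_nonzero_values_imp_summable_on) (rule finite_subset[of _ "{\<one>}"], auto)
    qed
    also have "(\<Sum>\<^sub>\<infinity>r\<in>carrier G. if r = \<one> then - \<sigma> * y \<one> else 0) = - \<sigma> * y \<one>"
      by (subst infsum_single[of \<one>]) auto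
    finally show ?thesis by simp
  qed
  have "(\<Sum>\<^sub>\<infinity>r\<in>carrier G. f r * \<xi> (t \<otimes> r)) = 0" if t: "t \<in> carrier G" for t
  proof (cases "t \<in> H")
    case True
    have "(\<Sum>\<^sub>\<infinity>r\<in>carrier G. g r * \<xi> (t \<otimes> r)) = (\<Sum>\<^sub>\<infinity>r\<in>carrier G. of_real (\<chi> t) * (g r * \<xi> r))"
      by (rule infsum_cong) (simp add: xi_mult[OF True])
    also have "\<dots> = of_real (\<chi> t) * \<sigma>" unfolding \<sigma>_def by (rule infsum_cmult_right')
    finally show ?thesis
      using split[OF dominated_shift[OF dominated_xi t]] True t by (simp add: xi_def)
  next
    case False
    have notin: "t \<otimes> r \<notin> H" if r: "r \<in> H" for r
    proof
      assume "t \<otimes> r \<in> H"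
      then have "(t \<otimes> r) \<otimes> inv r \<in> H" using r by simp
      then show False using False t r by (simp add: m_assoc)
    qed
    have "(\<Sum>\<^sub>\<infinity>r\<in>carrier G. f r * \<xi> (t \<otimes> r)) = (\<Sum>\<^sub>\<infinity>r\<in>carrier G. 0)"
    proof (rule infsum_cong)
      fix r assume "r \<in> carrier G"
      show "f r * \<xi> (t \<otimes> r) = 0"
      proof (cases "r \<in> H")
        case True then show ?thesis using notin by (simp add: xi_def)
      next
        case False
        then have "r \<noteq> \<one>" by auto
        then show ?thesis using False by (simp add: f g_def)
      qed
    qed
    then show ?thesis by simp
  qed
  then have "f \<in> J" using fA by (simp add: J_def)
  moreover have "\<beta> h * (v h / (\<omega> h / \<chi> h)) \<le> cmod (\<Sum>\<^sub>\<infinity>r\<in>carrier G. f r * (\<xi> r * of_real (v r)))"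
    if v: "v \<one> = 0" "\<forall>x. 0 \<le> v x \<and> v x \<le> R" and h: "h \<in> H" for v R h
  proof -
    define y :: "'a \<Rightarrow> complex" where "y r = \<xi> r * of_real (v r)" for r
    define z where "z r = (if r \<in> H then \<beta> r * (v r / (\<omega> r / \<chi> r)) else 0)" for r
    have y: "dominated y R"
      unfolding dominated_def
    proof
      fix r assume r: "r \<in> carrier G"
      have "cmod (\<xi> r) \<le> \<omega> r" using dominated_xi r by (simp add: dominated_def)
      then have "cmod (\<xi> r) * v r \<le> \<omega> r * R" using v(2)[rule_format, of r] weight_ge_0[OF r] by (intro mult_mono) auto
      then show "cmod (y r) \<le> R * \<omega> r" using v(2)[rule_format, of r] by (simp add: y_def norm_mult mult.commute)
    qed
    have z: "of_real (z r) = g r * y r" for r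
      by (simp add: z_def g_def y_def xi_def)
    have sum: "(\<lambda>r. complex_of_real (z r)) summable_on carrier G"
      unfolding z by (rule pairing_summable[OF gA y])
    then have zsum: "z summable_on carrier G"
      using summable_on_Re by fastforce
    have "0 \<le> z r" for r
      using \<beta>(2)[of r] v(2)[rule_format, of r] weight_ge_0[of r] character_pos[of r] by (auto simp: z_def)
    then have "z h \<le> infsum z (carrier G)"
      using finite_sum_le_infsum[OF zsum, of "{h}"] h by simp
    also have "\<dots> \<le> cmod (of_real (infsum z (carrier G)))" by simp
    also have "complex_of_real (infsum z (carrier G)) = (\<Sum>\<^sub>\<infinity>r\<in>carrier G. complex_of_real (z r))"
      by (rule infsumI[OF has_sum_of_real[OF has_sum_infsum[OF zsum]], symmetric])
    also have "\<dots> = (\<Sum>\<^sub>\<infinity>r\<in>carrier G. g r * y r)" unfolding z ..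
    also have "\<dots> = (\<Sum>\<^sub>\<infinity>r\<in>carrier G. f r * y r)"
      using split[OF y] v(1) by (simp add: y_def)
    finally show ?thesis using h by (simp add: z_def y_def)
  qed
  ultimately show ?thesis by (intro bexI[of _ f] allI impI ballI) blast+
qed

text \<open>The functionals \<open>u R\<close> are \<open>\<xi>\<close> times the path metric cut off at \<open>R\<close>. For a generator \<open>f \<in> J\<close> the coset sums of
\<open>f\<close> vanish, hence only differences of distances enter its pairing with a translate of \<open>u R\<close>, and these are
controlled by the edge lengths. So \<open>J\<close> lies in \<open>bounded_against u\<close>, and pairing with test elements bounds the
distance by a multiple of \<open>w\<close>.\<close>
theorem exponential_growth_if_finitely_generated_J:
  assumes "finitely_generated_left_ideal J A"
  shows "\<exists>L c a. finite L \<and> L \<subseteq> H \<and> 0 < c \<and> 1 < a \<and>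
    (\<forall>h\<in>H. \<exists>n. word_of_length L n h \<and> c * a ^ n \<le> \<omega> h / \<chi> h)"
proof -
  obtain S where S: "finite S" "S \<subseteq> J" and gen: "\<And>K. left_ideal K A \<Longrightarrow> S \<subseteq> K \<Longrightarrow> J \<subseteq> K"
    using assms unfolding A.finitely_generated_left_ideal_iff by blast
  have SA: "f \<in> carrier A" if "f \<in> S" for f using that S(2) by (auto simp: J_def)
  have TG: "t \<in> carrier G" if "t \<in> T" for t using that T(2) by auto
  \<comment> \<open>All generators at once, restricted to the cosets of \<open>H\<close> and moved into \<open>H\<close>.\<close>
  define b where "b h = (\<Sum>f\<in>S. \<Sum>t\<in>T. cmod (f (t \<otimes> h)) * \<omega> h)" for h
  have "b summable_on carrier G"
    unfolding b_def
  proof (intro summable_on_sum_finite S(1) T(1))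
    fix f t assume f: "f \<in> S" and t: "t \<in> T"
    show "(\<lambda>h. cmod (f (t \<otimes> h)) * \<omega> h) summable_on carrier G"
    proof (rule summable_on_comparison_test)
      show "(\<lambda>h. \<omega> (inv t) * (cmod (f (t \<otimes> h)) * \<omega> (t \<otimes> h))) summable_on carrier G"
        by (intro summable_on_cmult_right summable_translate[OF TG[OF t]] A_summable SA f)
      fix h assume h: "h \<in> carrier G"
      have "\<omega> h = \<omega> (inv t \<otimes> (t \<otimes> h))" using TG[OF t] h by (simp add: m_assoc[symmetric])
      also have "\<dots> \<le> \<omega> (inv t) * \<omega> (t \<otimes> h)" using TG[OF t] h by (intro weight_mult) auto
      finally have "cmod (f (t \<otimes> h)) * \<omega> h \<le> cmod (f (t \<otimes> h)) * (\<omega> (inv t) * \<omega> (t \<otimes> h))"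
        by (rule mult_left_mono) simp
      then show "cmod (f (t \<otimes> h)) * \<omega> h \<le> \<omega> (inv t) * (cmod (f (t \<otimes> h)) * \<omega> (t \<otimes> h))"
        by (simp add: mult_ac)
    qed (simp add: weight_ge_0)
  qed
  then have bH: "b summable_on H" by (rule summable_on_subset_banach) auto
  have b0: "0 \<le> b h" if "h \<in> H" for h
    unfolding b_def using that weight_ge_0 by (intro sum_nonneg) auto
  have b_ge: "cmod (f (t \<otimes> h)) * \<omega> h \<le> b h" if "f \<in> S" "t \<in> T" "h \<in> H" for f t h
  proof -
    have "cmod (f (t \<otimes> h)) * \<omega> h \<le> (\<Sum>t\<in>T. cmod (f (t \<otimes> h)) * \<omega> h)"
      using that T(1) weight_ge_0 by (intro member_le_sum) auto
    also have "\<dots> \<le> b h" unfolding b_def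
      using that S(1) weight_ge_0 by (intro member_le_sum[of f S "\<lambda>f. \<Sum>t\<in>T. cmod (f (t \<otimes> h)) * \<omega> h"] sum_nonneg) auto
    finally show ?thesis .
  qed
  obtain \<eta> :: "'a \<Rightarrow> real" where \<eta>: "\<And>x. 1 \<le> \<eta> x" "(\<lambda>x. b x * \<eta> x) summable_on H"
    "\<And>C. finite {x \<in> H. b x \<noteq> 0 \<and> \<eta> x \<le> C}"
    using slow_weight_exists[OF bH b0] by blast
  define w where "w h = \<omega> h / \<chi> h" for h
  define L where "L = {l \<in> H. b l \<noteq> 0}"
  interpret P: path_metric G H w \<eta> L
  proof unfold_locales
    show "w (h \<otimes> k) \<le> w h * w k" if "h \<in> H" "k \<in> H" for h k
      unfolding w_def by (rule twisted_weight(2)[OF that])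
  qed (use H \<eta>(1) twisted_weight(1) in \<open>auto simp: L_def w_def\<close>)
  define u where "u R r = \<xi> r * of_real (P.dist_upto R r)" for R r
  have u: "dominated (u R) R" if R: "0 \<le> R" for R
    unfolding dominated_def
  proof
    fix r assume r: "r \<in> carrier G"
    have "cmod (\<xi> r) \<le> \<omega> r" using dominated_xi r by (simp add: dominated_def)
    then have "cmod (\<xi> r) * P.dist_upto R r \<le> \<omega> r * R"
      using P.dist_upto_bounds[OF R, of r] weight_ge_0[OF r] by (intro mult_mono) auto
    then show "cmod (u R r) \<le> R * \<omega> r"
      using P.dist_upto_bounds[OF R, of r] by (simp add: u_def norm_mult mult.commute)
  qed
  define M where "M = (\<Sum>\<^sub>\<infinity>h\<in>H. b h * \<eta> h)"
  define B where "B q = (if q \<in> H then b q * \<eta> q else 0)" for q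
  have B: "(B has_sum M) (carrier G)"
  proof -
    have "((\<lambda>h. b h * \<eta> h) has_sum M) H" unfolding M_def using \<eta>(2) by simp
    moreover have "((\<lambda>h. b h * \<eta> h) has_sum M) H \<longleftrightarrow> (B has_sum M) (carrier G)"
      by (rule has_sum_cong_neutral) (auto simp: B_def)
    ultimately show ?thesis by simp
  qed
  have "0 \<le> B q" for q using b0 \<eta>(1)[of q] by (auto simp: B_def)
  then have M0: "0 \<le> M" using has_sum_nonneg[OF B] by blast
  have "S \<subseteq> bounded_against u"
  proof
    fix f assume f: "f \<in> S"
    have fJ: "f \<in> J" using f S(2) by blast
    have "dominated (\<lambda>s. \<Sum>\<^sub>\<infinity>r\<in>carrier G. f r * u R (s \<otimes> r)) (M * (\<Sum>t\<in>T. \<omega> t))" if R: "0 \<le> R" for R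
      unfolding dominated_def
    proof
      fix s assume s: "s \<in> carrier G"
      obtain t where t: "t \<in> T" "s \<otimes> t \<in> H" using transversal[OF s] by blast
      define h where "h = s \<otimes> t"
      have h: "h \<in> H" using t by (simp add: h_def)
      have tG: "t \<in> carrier G" using TG t by blast
      let ?d = "P.dist_upto R"
      have "(\<Sum>\<^sub>\<infinity>q\<in>carrier G. f (t \<otimes> q) * \<xi> q) = (\<Sum>\<^sub>\<infinity>r\<in>carrier G. f r * \<xi> (inv t \<otimes> r))"
        using translate_sum[OF tG, of "\<lambda>q r. f r * \<xi> q"] by simp
      also have "\<dots> = 0" using fJ tG by (simp add: J_def)
      finally have zero: "(\<Sum>\<^sub>\<infinity>q\<in>carrier G. f (t \<otimes> q) * \<xi> q) = 0" .
      have s1: "(\<lambda>q. f (t \<otimes> q) * \<xi> q) summable_on carrier G"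
      proof -
        have "(\<lambda>r. f r * \<xi> (inv t \<otimes> r)) summable_on carrier G"
          using J_summable[OF SA[OF f]] tG by simp
        from summable_translate[OF tG this] show ?thesis
          by (rule summable_on_cong[THEN iffD1, rotated]) (use tG in \<open>simp add: m_assoc[symmetric]\<close>)
      qed
      have s2: "(\<lambda>q. f (t \<otimes> q) * u R (h \<otimes> q)) summable_on carrier G"
        using summable_translate[OF tG pairing_summable[OF SA[OF f] dominated_shift[OF u[OF R] s]]]
        by (rule summable_on_cong[THEN iffD1, rotated]) (use tG s in \<open>simp add: m_assoc h_def\<close>)
      \<comment> \<open>Subtracting the constant value of the distance at \<open>h\<close> does not change the sum, by \<open>zero\<close>.\<close>
      define z where "z = complex_of_real (\<chi> h * ?d h)"
      have "(\<Sum>\<^sub>\<infinity>r\<in>carrier G. f r * u R (s \<otimes> r)) = (\<Sum>\<^sub>\<infinity>q\<in>carrier G. f (t \<otimes> q) * u R (h \<otimes> q))"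
        using translate_sum[OF tG, of "\<lambda>q r. f r * u R (s \<otimes> r)"] s tG
        by (simp add: h_def m_assoc cong: infsum_cong)
      also have "\<dots> = (\<Sum>\<^sub>\<infinity>q\<in>carrier G. f (t \<otimes> q) * u R (h \<otimes> q)) + (- z) * (\<Sum>\<^sub>\<infinity>q\<in>carrier G. f (t \<otimes> q) * \<xi> q)"
        by (simp add: zero)
      also have "\<dots> = (\<Sum>\<^sub>\<infinity>q\<in>carrier G. f (t \<otimes> q) * u R (h \<otimes> q) + (- z) * (f (t \<otimes> q) * \<xi> q))"
        by (subst infsum_add[OF s2 summable_on_cmult_right[OF s1]]) (simp only: infsum_cmult_right')
      finally have eq: "(\<Sum>\<^sub>\<infinity>r\<in>carrier G. f r * u R (s \<otimes> r))
        = (\<Sum>\<^sub>\<infinity>q\<in>carrier G. f (t \<otimes> q) * u R (h \<otimes> q) + (- z) * (f (t \<otimes> q) * \<xi> q))" .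
      have "cmod (\<Sum>\<^sub>\<infinity>r\<in>carrier G. f r * u R (s \<otimes> r)) \<le> \<omega> h * M"
        unfolding eq
      proof (rule norm_infsum_le[OF has_sum_infsum has_sum_cmult_right[OF B]])
        show "(\<lambda>q. f (t \<otimes> q) * u R (h \<otimes> q) + (- z) * (f (t \<otimes> q) * \<xi> q)) summable_on carrier G"
          by (rule summable_on_add[OF s2 summable_on_cmult_right[OF s1]])
        fix q assume q: "q \<in> carrier G"
        show "cmod (f (t \<otimes> q) * u R (h \<otimes> q) + (- z) * (f (t \<otimes> q) * \<xi> q)) \<le> \<omega> h * B q"
        proof (cases "q \<in> H \<and> f (t \<otimes> q) \<noteq> 0")
          case False
          then have vanish: "f (t \<otimes> q) * u R (h \<otimes> q) + (- z) * (f (t \<otimes> q) * \<xi> q) = 0"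
            using h q by (auto simp: u_def xi_def mult_in_H_iff)
          have "0 \<le> \<omega> h * B q" using \<open>0 \<le> B q\<close> weight_ge_0[of h] h by simp
          then show ?thesis unfolding vanish by simp
        next
          case True
          then have qH: "q \<in> H" by simp
          have "0 < cmod (f (t \<otimes> q)) * \<omega> q" using True weight_ge_1[OF q] by simp
          then have "q \<in> L" using b_ge[OF f t(1) qH] qH by (auto simp: L_def)
          then have lip: "\<bar>?d (h \<otimes> q) - ?d h\<bar> \<le> w h * (w q * \<eta> q)"
            by (rule P.dist_upto_Lipschitz[OF R h])
          have "f (t \<otimes> q) * u R (h \<otimes> q) + (- z) * (f (t \<otimes> q) * \<xi> q)
            = f (t \<otimes> q) * of_real (\<chi> h * \<chi> q * (?d (h \<otimes> q) - ?d h))"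
            using h qH by (simp add: u_def z_def xi_def character_mult algebra_simps)
          then have "cmod (f (t \<otimes> q) * u R (h \<otimes> q) + (- z) * (f (t \<otimes> q) * \<xi> q))
            = cmod (f (t \<otimes> q)) * (\<chi> h * \<chi> q * \<bar>?d (h \<otimes> q) - ?d h\<bar>)"
            using character_pos[OF h] character_pos[OF qH] by (simp add: norm_mult abs_mult del: of_real_mult of_real_diff)
          also have "\<dots> \<le> cmod (f (t \<otimes> q)) * (\<chi> h * \<chi> q * (w h * (w q * \<eta> q)))"
            using lip character_pos[OF h] character_pos[OF qH] by (intro mult_left_mono) auto
          also have "\<dots> = \<omega> h * (cmod (f (t \<otimes> q)) * \<omega> q * \<eta> q)"
            using character_pos[OF h] character_pos[OF qH] by (simp add: w_def)
          also have "\<dots> \<le> \<omega> h * (b q * \<eta> q)"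
            using b_ge[OF f t(1) qH] \<eta>(1)[of q] weight_ge_0[of h] h
            by (intro mult_left_mono mult_right_mono) auto
          finally show ?thesis using qH by (simp add: B_def)
        qed
      qed
      also have "\<dots> \<le> (\<omega> s * (\<Sum>t\<in>T. \<omega> t)) * M"
      proof (rule mult_right_mono[OF _ M0])
        have "\<omega> h \<le> \<omega> s * \<omega> t" unfolding h_def by (rule weight_mult[OF s tG])
        also have "\<dots> \<le> \<omega> s * (\<Sum>t\<in>T. \<omega> t)"
          using T(1) t(1) TG weight_ge_0 s by (intro mult_left_mono member_le_sum) auto
        finally show "\<omega> h \<le> \<omega> s * (\<Sum>t\<in>T. \<omega> t)" .
      qed
      finally show "cmod (\<Sum>\<^sub>\<infinity>r\<in>carrier G. f r * u R (s \<otimes> r)) \<le> M * (\<Sum>t\<in>T. \<omega> t) * \<omega> s"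
        by (simp add: mult_ac)
    qed
    then show "f \<in> bounded_against u" using SA[OF f] unfolding bounded_against_def by blast
  qed
  moreover have "\<exists>K. dominated (u R) K" if "0 \<le> R" for R using u[OF that] by blast
  then have "left_ideal (bounded_against u) A" by (rule left_ideal_bounded_against)
  ultimately have JB: "J \<subseteq> bounded_against u" using gen by blast
  have "\<exists>C. \<forall>R :: nat. \<forall>h\<in>H. P.dist_upto (real R) h / w h \<le> C"
  proof (rule uniformly_bounded_if_multipliers)
    fix \<beta> :: "'a \<Rightarrow> real" assume \<beta>: "\<beta> summable_on H" "\<And>x. 0 \<le> \<beta> x"
    obtain f where f: "f \<in> J" and test: "\<forall>v R. v \<one> = 0 \<longrightarrow> (\<forall>x. 0 \<le> v x \<and> v x \<le> R) \<longrightarrow> (\<forall>h\<in>H.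
        \<beta> h * (v h / (\<omega> h / \<chi> h)) \<le> cmod (\<Sum>\<^sub>\<infinity>r\<in>carrier G. f r * (\<xi> r * of_real (v r))))"
      using J_test_element[OF \<beta>] ..
    obtain K where K: "\<And>R. 0 \<le> R \<Longrightarrow> dominated (\<lambda>s. \<Sum>\<^sub>\<infinity>r\<in>carrier G. f r * u R (s \<otimes> r)) K"
      using f JB by (auto simp: bounded_against_def)
    have "\<beta> h * (P.dist_upto (real R) h / w h) \<le> K" if h: "h \<in> H" for R :: nat and h
    proof -
      have "\<beta> h * (P.dist_upto (real R) h / w h) \<le> cmod (\<Sum>\<^sub>\<infinity>r\<in>carrier G. f r * u (real R) r)"
        unfolding u_def
        by (rule test[folded w_def, rule_format, of "P.dist_upto (real R)" "real R"])
          (auto simp: P.dist_upto_one P.dist_upto_bounds h)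
      also have "(\<Sum>\<^sub>\<infinity>r\<in>carrier G. f r * u (real R) r) = (\<Sum>\<^sub>\<infinity>r\<in>carrier G. f r * u (real R) (\<one> \<otimes> r))"
        by (rule infsum_cong) simp
      also have "cmod \<dots> \<le> K * \<omega> \<one>" using K[of "real R"] by (simp add: dominated_def)
      finally show ?thesis by (simp add: weight_one)
    qed
    then show "\<exists>K. \<forall>R :: nat. \<forall>h\<in>H. \<beta> h * (P.dist_upto (real R) h / w h) \<le> K" by blast
  qed
  then obtain C0 where C0: "\<And>R :: nat. \<And>h. h \<in> H \<Longrightarrow> P.dist_upto (real R) h / w h \<le> C0" by blast
  define C where "C = max 1 C0"
  have C: "1 \<le> C" by (simp add: C_def)
  have bound: "P.dist_upto (real R) h \<le> C * w h" if "h \<in> H" for R :: nat and h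
  proof -
    have "P.dist_upto (real R) h / w h \<le> C" using C0[OF that, of R] by (simp add: C_def)
    then show ?thesis using P.w1[OF that] by (simp add: divide_le_eq)
  qed
  define a where "a = (C + 1) / C"
  have a: "1 < a" unfolding a_def using C by (simp add: field_simps)
  show ?thesis
  proof (rule exI[of _ "{l \<in> L. \<eta> l \<le> C + 1}"], rule exI[of _ "1 / (a * (C + 1))"], rule exI[of _ a],
      intro conjI ballI)
    show "finite {l \<in> L. \<eta> l \<le> C + 1}"
      using \<eta>(3)[of "C + 1"] by (rule finite_subset[rotated]) (auto simp: L_def)
    show "{l \<in> L. \<eta> l \<le> C + 1} \<subseteq> H" by (auto simp: L_def)
    show "0 < 1 / (a * (C + 1))" using a C by simp
    show "1 < a" by (rule a)
    show "\<exists>n. word_of_length {l \<in> L. \<eta> l \<le> C + 1} n h \<and> 1 / (a * (C + 1)) * a ^ n \<le> \<omega> h / \<chi> h"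
      if "h \<in> H" for h
      using P.exponential_growth[OF C bound that] unfolding a_def w_def by blast
  qed
qed

end

section \<open>Characters that defeat exponential growth\<close>

context group begin

text \<open>Finite index in the form required of \<open>T\<close> in \<open>beurling_character\<close>, without exactness of the system of
representatives.\<close>
definition finite_index :: "'a set \<Rightarrow> bool" where
  "finite_index H \<longleftrightarrow> subgroup H G \<and>
    (\<exists>T. finite T \<and> T \<subseteq> carrier G \<and> (\<forall>g\<in>carrier G. \<exists>t\<in>T. g \<otimes> t \<in> H))"

text \<open>In a system \<open>T\<close> of least size no two elements serve the same \<open>g\<close>: if \<open>g \<otimes> s\<close> and \<open>g \<otimes> t\<close> lie in \<open>H\<close>, then \<open>s\<close>
and \<open>t\<close> can replace each other for every element of the group.\<close>
lemma finite_index_transversal: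
  assumes "finite_index H"
  shows "\<exists>T. finite T \<and> T \<subseteq> carrier G \<and> (\<forall>g\<in>carrier G. \<exists>!t. t \<in> T \<and> g \<otimes> t \<in> H)"
proof -
  define P where "P T \<longleftrightarrow> finite T \<and> T \<subseteq> carrier G \<and> (\<forall>g\<in>carrier G. \<exists>t\<in>T. g \<otimes> t \<in> H)" for T
  have H: "subgroup H G" and "\<exists>T. P T" using assms by (auto simp: finite_index_def P_def)
  then obtain T where T: "P T" and min: "\<And>S. P S \<Longrightarrow> card T \<le> card S"
    using ex_has_least_nat[of P _ card] by blast
  have "s = t" if st: "s \<in> T" "t \<in> T" "g \<in> carrier G" "g \<otimes> s \<in> H" "g \<otimes> t \<in> H" for g s t
  proof (rule ccontr)
    assume "s \<noteq> t"
    have c: "s \<in> carrier G" "t \<in> carrier G" using st T by (auto simp: P_def)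
    have "inv (g \<otimes> s) \<otimes> (g \<otimes> t) \<in> H" using H st by (simp add: subgroup.m_closed subgroup.m_inv_closed)
    also have "inv (g \<otimes> s) \<otimes> (g \<otimes> t) = inv s \<otimes> t"
    proof -
      have "inv g \<otimes> (g \<otimes> t) = t" using c st(3) by (simp add: m_assoc[symmetric])
      then show ?thesis using c st(3) by (simp add: inv_mult_group m_assoc)
    qed
    finally have d: "inv s \<otimes> t \<in> H" .
    have "\<exists>u\<in>T - {s}. k \<otimes> u \<in> H" if k: "k \<in> carrier G" for k
    proof (cases "k \<otimes> s \<in> H")
      case True
      have "(k \<otimes> s) \<otimes> (inv s \<otimes> t) \<in> H" using True d H by (simp add: subgroup.m_closed)
      moreover have "(k \<otimes> s) \<otimes> (inv s \<otimes> t) = k \<otimes> t"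
      proof -
        have "s \<otimes> (inv s \<otimes> t) = t" using c by (simp add: m_assoc[symmetric])
        then show ?thesis using k c by (simp add: m_assoc)
      qed
      ultimately show ?thesis using st(2) \<open>s \<noteq> t\<close> by auto
    next
      case False
      then show ?thesis using T k by (auto simp: P_def)
    qed
    then have "P (T - {s})" using T by (auto simp: P_def)
    then have "card T \<le> card (T - {s})" by (rule min)
    moreover have "card (T - {s}) < card T" using T st(1) unfolding P_def by (metis card_Diff1_less)
    ultimately show False by simp
  qed
  then have "\<forall>g\<in>carrier G. \<exists>!t. t \<in> T \<and> g \<otimes> t \<in> H" using T unfolding P_def by metis
  then show ?thesis using T unfolding P_def by blast
qed

lemma word_of_length_generate:
  assumes "word_of_length L n h" "L \<subseteq> carrier G"
  shows "h \<in> generate G L"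
  using assms
  by (induction rule: word_of_length.induct) (auto intro: generate.intros)

lemma word_of_length_additive:
  fixes \<phi> :: "'a \<Rightarrow> real"
  assumes H: "subgroup H G" and L: "L \<subseteq> H" "finite L"
    and \<phi>: "\<And>h k. h \<in> H \<Longrightarrow> k \<in> H \<Longrightarrow> \<phi> (h \<otimes> k) = \<phi> h + \<phi> k"
    and w: "word_of_length L n h"
  shows "h \<in> H \<and> \<bar>\<phi> h\<bar> \<le> n * (\<Sum>l\<in>L. \<bar>\<phi> l\<bar>)"
proof -
  have one: "\<phi> \<one> = 0" using \<phi>[of \<one> \<one>] H by (simp add: subgroup.one_closed)
  have inv: "\<phi> (inv l) = - \<phi> l" if "l \<in> H" for l
    using \<phi>[of l "inv l"] that H one subgroup.mem_carrier[OF H that] by (simp add: subgroup.m_inv_closed)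
  have le: "\<bar>\<phi> l\<bar> \<le> (\<Sum>l\<in>L. \<bar>\<phi> l\<bar>)" if "l \<in> L" for l
    using L(2) that by (intro member_le_sum) auto
  show ?thesis using w
  proof (induction rule: word_of_length.induct)
    case empty then show ?case using H one by (simp add: subgroup.one_closed)
  next
    case (step n g l)
    moreover have "l \<in> H" using step L by auto
    ultimately show ?case using le[of l] H \<phi>[of g l] by (auto simp: subgroup.m_closed distrib_right)
  next
    case (step_inv n g l)
    moreover have "l \<in> H" using step_inv L by auto
    ultimately show ?case using le[of l] H \<phi>[of g "inv l"] inv[of l]
      by (auto simp: subgroup.m_closed subgroup.m_inv_closed distrib_right)
  qed
qed

end

context beurling begin

text \<open>For the trivial character the growth theorem still says that \<open>H\<close> is finitely generated as a group.\<close>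
lemma infinitely_generated_imp_not_finitely_generated:
  assumes H: "finite_index H" and not_fg: "\<And>L. finite L \<Longrightarrow> L \<subseteq> H \<Longrightarrow> generate G L \<noteq> H"
  shows "\<exists>I. left_ideal I A \<and> finite_codimension I A \<and> \<not> finitely_generated_left_ideal I A"
proof -
  obtain T where T: "finite T" "T \<subseteq> carrier G" "\<forall>g\<in>carrier G. \<exists>!t. t \<in> T \<and> g \<otimes> t \<in> H"
    using finite_index_transversal[OF H] by blast
  have sub: "subgroup H G" using H by (simp add: finite_index_def)
  interpret C: beurling_character G \<omega> H T "\<lambda>h. 1"
    by (intro beurling_character.intro beurling_axioms beurling_character_axioms.intro)
      (use T sub weight_ge_1 subgroup.mem_carrier[OF sub] in auto)
  have "\<not> finitely_generated_left_ideal C.J A"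
  proof
    assume "finitely_generated_left_ideal C.J A"
    then obtain L c and a :: real where L: "finite L" "L \<subseteq> H"
      and words: "\<forall>h\<in>H. \<exists>n. word_of_length L n h \<and> c * a ^ n \<le> \<omega> h / 1"
      using C.exponential_growth_if_finitely_generated_J by blast
    have "H \<subseteq> generate G L" using words word_of_length_generate[of L] L C.H_carrier by blast
    moreover have "generate G L \<subseteq> H" by (rule generate_subgroup_incl[OF L(2) sub])
    ultimately show False using not_fg[OF L] by blast
  qed
  then show ?thesis using C.left_ideal_J C.finite_codimension_J by blast
qed

text \<open>With \<open>c0\<close> the least slope of \<open>ln \<omega>\<close> against \<open>\<phi>\<close> in the direction \<open>\<phi> > 0\<close>, the character \<open>exp (c0 * \<phi>)\<close> is
dominated by \<open>\<omega>\<close>; in the opposite direction it is at most \<open>1\<close>. The powers of an element of nearly least slope have a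
twisted weight of arbitrarily small exponential rate, measured by \<open>\<phi>\<close> and therefore also by word length. Since
such an \<open>h\<close> may have small \<open>\<phi> h\<close>, it is the passage to powers that makes the rate meaningful.\<close>
lemma additive_function_imp_not_finitely_generated:
  fixes \<phi> :: "'a \<Rightarrow> real"
  assumes H: "finite_index H"
    and \<phi>: "\<And>h k. h \<in> H \<Longrightarrow> k \<in> H \<Longrightarrow> \<phi> (h \<otimes> k) = \<phi> h + \<phi> k"
    and nonzero: "h0 \<in> H" "\<phi> h0 \<noteq> 0"
  shows "\<exists>I. left_ideal I A \<and> finite_codimension I A \<and> \<not> finitely_generated_left_ideal I A"
proof -
  obtain T where T: "finite T" "T \<subseteq> carrier G" "\<forall>g\<in>carrier G. \<exists>!t. t \<in> T \<and> g \<otimes> t \<in> H"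
    using finite_index_transversal[OF H] by blast
  have sub: "subgroup H G" using H by (simp add: finite_index_def)
  have HG: "h \<in> carrier G" if "h \<in> H" for h using subgroup.mem_carrier[OF sub that] .
  have one: "\<phi> \<one> = 0" using \<phi>[of \<one> \<one>] sub by (simp add: subgroup.one_closed)
  define slopes where "slopes = {ln (\<omega> h) / \<phi> h | h. h \<in> H \<and> 0 < \<phi> h}"
  define c0 where "c0 = Inf slopes"
  have "\<phi> (inv h0) = - \<phi> h0"
    using \<phi>[of h0 "inv h0"] nonzero one HG[OF nonzero(1)] subgroup.m_inv_closed[OF sub nonzero(1)] by simp
  then have "\<exists>h\<in>H. 0 < \<phi> h"
    using nonzero subgroup.m_inv_closed[OF sub nonzero(1)] by (cases "0 < \<phi> h0") (auto intro: bexI[of _ h0] bexI[of _ "inv h0"])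
  then have ne: "slopes \<noteq> {}" by (auto simp: slopes_def)
  have slopes0: "0 \<le> x" if "x \<in> slopes" for x
    using that weight_ge_1 HG by (auto simp: slopes_def)
  then have bdd: "bdd_below slopes" by (intro bdd_belowI[of _ 0]) auto
  have c0: "0 \<le> c0" unfolding c0_def using ne slopes0 by (intro cInf_greatest) auto
  have le: "exp (c0 * \<phi> h) \<le> \<omega> h" if h: "h \<in> H" for h
  proof (cases "0 < \<phi> h")
    case True
    have "c0 \<le> ln (\<omega> h) / \<phi> h" unfolding c0_def
      by (rule cInf_lower[OF _ bdd]) (use True h in \<open>auto simp: slopes_def\<close>)
    then have "c0 * \<phi> h \<le> ln (\<omega> h)" using True by (simp add: le_divide_eq)
    then have "exp (c0 * \<phi> h) \<le> exp (ln (\<omega> h))" by simp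
    then show ?thesis using weight_ge_1[OF HG[OF h]] by simp
  next
    case False
    then have "c0 * \<phi> h \<le> 0" using c0 by (simp add: mult_nonneg_nonpos)
    then have "exp (c0 * \<phi> h) \<le> 1" by simp
    then show ?thesis using weight_ge_1[OF HG[OF h]] by (rule order_trans)
  qed
  interpret C: beurling_character G \<omega> H T "\<lambda>h. exp (c0 * \<phi> h)"
    by (intro beurling_character.intro beurling_axioms beurling_character_axioms.intro)
      (use T sub le \<phi> in \<open>auto simp: distrib_left exp_add\<close>)
  have "\<not> finitely_generated_left_ideal C.J A"
  proof
    assume "finitely_generated_left_ideal C.J A"
    then obtain L c a where L: "finite L" "L \<subseteq> H" and c: "0 < c" and a: "1 < a"
      and words: "\<And>h. h \<in> H \<Longrightarrow> \<exists>n. word_of_length L n h \<and> c * a ^ n \<le> \<omega> h / exp (c0 * \<phi> h)"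
      using C.exponential_growth_if_finitely_generated_J by blast
    define M where "M = 1 + (\<Sum>l\<in>L. \<bar>\<phi> l\<bar>)"
    have M: "1 \<le> M" by (simp add: M_def sum_nonneg)
    \<comment> \<open>Half of the rate, with respect to \<open>\<phi>\<close>, that exponential growth with base \<open>a\<close> would enforce.\<close>
    define e where "e = ln a / (2 * M)"
    have e: "0 < e" using a M by (simp add: e_def)
    have "Inf slopes < c0 + e" using e by (simp add: c0_def)
    then obtain x where "x \<in> slopes" "x < c0 + e" using cInf_lessD[OF ne] by blast
    then obtain h where h: "h \<in> H" "0 < \<phi> h" "ln (\<omega> h) / \<phi> h < c0 + e" by (auto simp: slopes_def)
    have lnh: "ln (\<omega> h) \<le> (c0 + e) * \<phi> h" using h by (simp add: divide_less_eq)
    have hG: "h \<in> carrier G" using HG h by blast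
    have pow: "h [^] k \<in> H \<and> \<phi> (h [^] k) = k * \<phi> h \<and> \<omega> (h [^] k) \<le> exp (k * ln (\<omega> h))" for k :: nat
    proof (induction k)
      case 0 then show ?case using one sub weight_one by (simp add: subgroup.one_closed)
    next
      case (Suc k)
      have "\<omega> (h [^] k \<otimes> h) \<le> \<omega> (h [^] k) * \<omega> h" using hG by (intro weight_mult) auto
      also have "\<dots> \<le> exp (k * ln (\<omega> h)) * exp (ln (\<omega> h))"
        using Suc weight_ge_1[OF hG] by (intro mult_mono) auto
      finally show ?case using Suc \<phi>[of "h [^] k" h] h(1) sub
        by (simp add: subgroup.m_closed algebra_simps exp_add)
    qed
    have small: "c * exp (e * \<phi> h * k) \<le> 1" for k :: nat
    proof -
      obtain n where n: "word_of_length L n (h [^] k)" "c * a ^ n \<le> \<omega> (h [^] k) / exp (c0 * \<phi> (h [^] k))"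
        using words pow by blast
      have "k * \<phi> h \<le> n * (\<Sum>l\<in>L. \<bar>\<phi> l\<bar>)"
        using word_of_length_additive[OF sub L(2,1), of \<phi>, OF \<phi> n(1)] pow[of k] by simp
      moreover have "n * (\<Sum>l\<in>L. \<bar>\<phi> l\<bar>) \<le> n * M" by (simp add: M_def mult_left_mono)
      ultimately have "k * \<phi> h \<le> n * M" by linarith
      then have "2 * e * (k * \<phi> h) \<le> 2 * e * (n * M)" by (rule mult_left_mono) (use e in simp)
      also have "2 * e * (n * M) = n * ln a" using M by (simp add: e_def)
      finally have "exp (2 * e * (k * \<phi> h)) \<le> exp (n * ln a)" by simp
      moreover have "exp (n * ln a) = a ^ n" using a by (simp add: exp_of_nat_mult)
      ultimately have "exp (2 * e * (k * \<phi> h)) \<le> a ^ n" by simp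
      then have "c * exp (2 * e * (k * \<phi> h)) \<le> c * a ^ n" using c by simp
      also have "\<dots> \<le> exp (k * ln (\<omega> h)) / exp (c0 * (k * \<phi> h))"
        using n(2) pow[of k] by (simp add: divide_right_mono order_trans)
      also have "\<dots> \<le> exp (k * ((c0 + e) * \<phi> h)) / exp (c0 * (k * \<phi> h))"
        using mult_left_mono[OF lnh, of "real k"] by (simp add: divide_right_mono)
      also have "\<dots> = exp (e * (k * \<phi> h))" by (simp add: algebra_simps flip: exp_diff)
      finally have "c * (exp (e * (k * \<phi> h)) * exp (e * (k * \<phi> h))) \<le> exp (e * (k * \<phi> h))"
        by (simp flip: exp_add) (simp add: mult_ac)
      then have "c * exp (e * (k * \<phi> h)) * exp (e * (k * \<phi> h)) \<le> 1 * exp (e * (k * \<phi> h))"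
        by (simp add: mult.assoc)
      then have "c * exp (e * (k * \<phi> h)) \<le> 1" by (rule mult_right_le_imp_le) simp
      then show ?thesis by (simp add: mult_ac)
    qed
    have pos: "0 < c * (e * \<phi> h)" using c e h(2) by simp
    obtain k :: nat where k: "1 < k * (c * (e * \<phi> h))" using reals_Archimedean3[OF pos] by blast
    have "e * \<phi> h * k \<le> exp (e * \<phi> h * k)"
      using exp_ge_add_one_self[of "e * \<phi> h * k"] by linarith
    then have "c * (e * \<phi> h * k) \<le> c * exp (e * \<phi> h * k)" using c by simp
    then show False using k small[of k] by (simp add: mult_ac)
  qed
  then show ?thesis using C.left_ideal_J C.finite_codimension_J by blast
qed

end

section \<open>Additive functions on subgroups of finite index\<close>

context group begin

lemma finite_index_if_finite_index_subgroup:
  assumes "finite_index_subgroup H G"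
  shows "finite_index H"
proof -
  have H: "subgroup H G" and fin: "finite (rcosets H)"
    using assms by (auto simp: finite_index_subgroup_def)
  define r where "r C = (SOME x. x \<in> C)" for C :: "'a set"
  have r: "r (H #> g) \<in> H #> g" if "g \<in> carrier G" for g
    unfolding r_def using rcos_self[OF that H] by (rule someI)
  have sub: "H #> g \<subseteq> carrier G" if "g \<in> carrier G" for g
    using r_coset_subset_G[OF subgroup.subset[OF H] that] .
  let ?T = "(\<lambda>C. inv (r C)) ` (rcosets H)"
  have "\<exists>t\<in>?T. g \<otimes> t \<in> H" if g: "g \<in> carrier G" for g
  proof -
    obtain h where h: "h \<in> H" "r (H #> g) = h \<otimes> g" using r[OF g] by (auto simp: r_coset_def)
    have hG: "h \<in> carrier G" using subgroup.mem_carrier[OF H h(1)] .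
    have "g \<otimes> inv (h \<otimes> g) = inv h"
      using g hG by (simp add: inv_mult_group m_assoc[symmetric])
    then have "g \<otimes> inv (r (H #> g)) \<in> H" using h(2) subgroup.m_inv_closed[OF H h(1)] by simp
    then show ?thesis using g by (auto simp: RCOSETS_def)
  qed
  moreover have "?T \<subseteq> carrier G" using r sub by (auto simp: RCOSETS_def)
  ultimately show ?thesis unfolding finite_index_def using H fin by (intro conjI exI[of _ ?T]) auto
qed

lemma finite_index_infinite:
  assumes "finite_index H" "infinite (carrier G)"
  shows "infinite H"
proof
  assume fin: "finite H"
  obtain T where T: "finite T" "T \<subseteq> carrier G" "\<forall>g\<in>carrier G. \<exists>t\<in>T. g \<otimes> t \<in> H"
    using assms(1) by (auto simp: finite_index_def)
  have "carrier G \<subseteq> (\<lambda>(h, t). h \<otimes> inv t) ` (H \<times> T)"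
  proof
    fix g assume g: "g \<in> carrier G"
    then obtain t where t: "t \<in> T" "g \<otimes> t \<in> H" using T by blast
    have "g = (g \<otimes> t) \<otimes> inv t" using g t T by (auto simp: m_assoc)
    then show "g \<in> (\<lambda>(h, t). h \<otimes> inv t) ` (H \<times> T)" using t by force
  qed
  then show False using fin T(1) assms(2) finite_subset by blast
qed

lemma finite_index_trans:
  assumes M: "finite_index M" and N: "subgroup N G"
    and S: "finite S" "S \<subseteq> carrier G" "\<And>m. m \<in> M \<Longrightarrow> \<exists>s\<in>S. m \<otimes> s \<in> N"
  shows "finite_index N"
proof -
  obtain T where T: "finite T" "T \<subseteq> carrier G" "\<And>g. g \<in> carrier G \<Longrightarrow> \<exists>t\<in>T. g \<otimes> t \<in> M"
    using M unfolding finite_index_def by blast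
  have "\<exists>u\<in>(\<lambda>(t, s). t \<otimes> s) ` (T \<times> S). g \<otimes> u \<in> N" if g: "g \<in> carrier G" for g
  proof -
    obtain t where t: "t \<in> T" "g \<otimes> t \<in> M" using T(3)[OF g] by blast
    obtain s where s: "s \<in> S" "(g \<otimes> t) \<otimes> s \<in> N" using S(3)[OF t(2)] by blast
    have "t \<in> carrier G" "s \<in> carrier G" using t s S T by auto
    then have "g \<otimes> (t \<otimes> s) \<in> N" using s g by (simp add: m_assoc)
    then show ?thesis using t s by force
  qed
  moreover have "(\<lambda>(t, s). t \<otimes> s) ` (T \<times> S) \<subseteq> carrier G" using T(2) S(2) by auto
  moreover have "finite ((\<lambda>(t, s). t \<otimes> s) ` (T \<times> S))" using T(1) S(1) by simp
  ultimately show ?thesis unfolding finite_index_def using N by (intro conjI exI[of _ "(\<lambda>(t, s). t \<otimes> s) ` (T \<times> S)"]) auto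
qed

lemma finite_index_mono:
  assumes "finite_index M" "subgroup N G" "M \<subseteq> N"
  shows "finite_index N"
  by (rule finite_index_trans[OF assms(1,2), of "{\<one>}"])
    (use assms(3) subgroup.mem_carrier[OF assms(2)] in auto)

text \<open>\<open>\<phi>\<close> reads off the exponent of \<open>x\<close>. Every element of the larger group is \<open>n \<otimes> x [^] i\<close> with \<open>n \<in> N\<close>, since \<open>x\<close>
normalises \<open>N\<close>. The exponent is unique, since a power \<open>x [^] e\<close> in \<open>N\<close> with \<open>e > 0\<close> would leave only the coset
representatives \<open>x [^] i\<close>, \<open>0 \<le> i < e\<close>, and give \<open>N\<close> finite index as well.\<close>
lemma cyclic_extension_additive:
  assumes N: "subgroup N G" and x: "x \<in> carrier G"
    and normal: "\<And>i :: int. \<And>n. n \<in> N \<Longrightarrow> x [^] i \<otimes> n \<otimes> x [^] (- i) \<in> N"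
    and fin: "finite_index (generate G (insert x N))" and inf: "\<not> finite_index N"
  shows "\<exists>\<phi> :: 'a \<Rightarrow> real. (\<forall>g\<in>generate G (insert x N). \<forall>h\<in>generate G (insert x N). \<phi> (g \<otimes> h) = \<phi> g + \<phi> h)
    \<and> \<phi> x \<noteq> 0"
proof -
  have NG: "n \<in> carrier G" if "n \<in> N" for n using subgroup.mem_carrier[OF N that] .
  define P where "P = {n \<otimes> x [^] i | n i :: int. n \<in> N}"
  let ?M = "generate G (insert x N)"
  have swap: "(n \<otimes> x [^] i) \<otimes> (m \<otimes> x [^] j) = (n \<otimes> (x [^] i \<otimes> m \<otimes> x [^] (- i))) \<otimes> x [^] (i + j)"
    if "n \<in> N" "m \<in> N" for n m and i j :: int
  proof -
    have "x [^] (- i) \<otimes> x [^] (i + j) = x [^] j" using x by (simp add: int_pow_mult[symmetric])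
    then show ?thesis using that NG x by (simp add: m_assoc)
  qed
  have "subgroup P G"
  proof (rule subgroupI)
    show "P \<subseteq> carrier G" using NG x by (auto simp: P_def)
    have "\<one> \<otimes> x [^] (0 :: int) \<in> P" unfolding P_def using subgroup.one_closed[OF N] by blast
    then show "P \<noteq> {}" by blast
  next
    fix a assume "a \<in> P"
    then obtain n and i :: int where n: "n \<in> N" "a = n \<otimes> x [^] i" unfolding P_def by blast
    have "inv a = x [^] (- i) \<otimes> inv n" using n NG x by (simp add: inv_mult_group int_pow_neg)
    also have "\<dots> = (x [^] (- i) \<otimes> inv n \<otimes> x [^] (- (- i))) \<otimes> x [^] (- i)"
      using n NG x by (simp add: m_assoc int_pow_mult[symmetric])
    finally show "inv a \<in> P"
      unfolding P_def using normal[OF subgroup.m_inv_closed[OF N n(1)], of "- i"] by blast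
  next
    fix a b assume "a \<in> P" "b \<in> P"
    then obtain n m and i j :: int where "n \<in> N" "a = n \<otimes> x [^] i" "m \<in> N" "b = m \<otimes> x [^] j"
      unfolding P_def by blast
    then show "a \<otimes> b \<in> P"
      unfolding P_def using swap[of n m i j] normal[of m i] subgroup.m_closed[OF N] by blast
  qed
  moreover have "insert x N \<subseteq> P"
  proof -
    have "\<one> \<otimes> x [^] (1 :: int) \<in> P" unfolding P_def using subgroup.one_closed[OF N] by blast
    moreover have "n \<otimes> x [^] (0 :: int) \<in> P" if "n \<in> N" for n unfolding P_def using that by blast
    ultimately show ?thesis using x NG by auto
  qed
  ultimately have MP: "?M \<subseteq> P" by (rule generate_subgroup_incl[rotated])
  have power_trivial: "d = 0" if d: "x [^] d \<in> N" for d :: int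
  proof (rule ccontr)
    assume "d \<noteq> 0"
    define e where "e = \<bar>d\<bar>"
    have e: "0 < e" using \<open>d \<noteq> 0\<close> by (simp add: e_def)
    have "x [^] e \<in> N"
      using d x subgroup.m_inv_closed[OF N d] by (cases "0 \<le> d") (auto simp: e_def int_pow_neg)
    then have mult: "x [^] (e * q) \<in> N" for q :: int
      using x subgroup_int_pow_closed[OF N, of "x [^] e" q] by (simp add: int_pow_pow)
    have "finite_index N"
    proof (rule finite_index_trans[OF fin N])
      show "finite ((\<lambda>i. x [^] i) ` {0..<e})" by simp
      show "(\<lambda>i. x [^] i) ` {0..<e} \<subseteq> carrier G" using x by auto
      fix m assume "m \<in> ?M"
      then obtain n and j :: int where n: "n \<in> N" "m = n \<otimes> x [^] j" using MP unfolding P_def by blast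
      have "j + (- j) mod e = e * (- ((- j) div e))"
        using mult_div_mod_eq[of e "- j"] unfolding mult_minus_right by linarith
      then have "x [^] (j + (- j) mod e) \<in> N" using mult by metis
      then have "n \<otimes> x [^] (j + (- j) mod e) \<in> N" using n(1) subgroup.m_closed[OF N] by blast
      moreover have "m \<otimes> x [^] ((- j) mod e) = n \<otimes> x [^] (j + (- j) mod e)"
        using n NG x by (simp add: m_assoc int_pow_mult)
      moreover have "(- j) mod e \<in> {0..<e}" using e by simp
      ultimately show "\<exists>s\<in>(\<lambda>i. x [^] i) ` {0..<e}. m \<otimes> s \<in> N" by (metis imageI)
    qed
    then show False using inf by simp
  qed
  define \<phi> where "\<phi> g = real_of_int (THE i. \<exists>n\<in>N. g = n \<otimes> x [^] i)" for g
  have \<phi>: "\<phi> (n \<otimes> x [^] i) = i" if n: "n \<in> N" for n and i :: int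
  proof -
    have "(THE j. \<exists>m\<in>N. n \<otimes> x [^] i = m \<otimes> x [^] j) = i"
    proof (rule the_equality)
      show "\<exists>m\<in>N. n \<otimes> x [^] i = m \<otimes> x [^] i" using n by blast
      fix j :: int assume "\<exists>m\<in>N. n \<otimes> x [^] i = m \<otimes> x [^] j"
      then obtain m where m: "m \<in> N" "n \<otimes> x [^] i = m \<otimes> x [^] j" by blast
      have "x [^] i = inv n \<otimes> (m \<otimes> x [^] j)" using n m NG x by (simp flip: m(2) add: m_assoc[symmetric])
      then have "x [^] i \<otimes> x [^] (- j) = (inv n \<otimes> m) \<otimes> (x [^] j \<otimes> x [^] (- j))"
        using n m(1) NG x by (simp add: m_assoc)
      then have "x [^] (i - j) = inv n \<otimes> m"
        using n m(1) NG x by (simp add: int_pow_mult[symmetric])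
      moreover have "inv n \<otimes> m \<in> N" using n m(1) N by (simp add: subgroup.m_closed subgroup.m_inv_closed)
      ultimately have "x [^] (i - j) \<in> N" by simp
      then show "j = i" using power_trivial by force
    qed
    then show ?thesis by (simp add: \<phi>_def)
  qed
  have "\<phi> (g \<otimes> h) = \<phi> g + \<phi> h" if "g \<in> ?M" "h \<in> ?M" for g h
  proof -
    obtain n m and i j :: int where nm: "n \<in> N" "g = n \<otimes> x [^] i" "m \<in> N" "h = m \<otimes> x [^] j"
      using \<open>g \<in> ?M\<close> \<open>h \<in> ?M\<close> MP unfolding P_def by blast
    have "n \<otimes> (x [^] i \<otimes> m \<otimes> x [^] (- i)) \<in> N"
      using normal[OF nm(3)] nm(1) subgroup.m_closed[OF N] by blast
    then show ?thesis unfolding nm(2,4) swap[OF nm(1,3)] by (simp only: \<phi> nm(1,3) of_int_add)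
  qed
  moreover have "\<phi> x = 1" using \<phi>[OF subgroup.one_closed[OF N], of 1] x by simp
  ultimately show ?thesis by (intro exI[of _ \<phi>]) simp
qed

text \<open>Adjoining the generators in \<open>L\<close> to the commutator subgroup one by one leads from infinite to finite index, so some
single generator \<open>x\<close> makes the difference. Subgroups between \<open>derived G K\<close> and \<open>K\<close> are normal in \<open>K\<close>. The subgroup \<open>M\<close>
may be smaller than \<open>K\<close>; for the purpose at hand any subgroup of finite index will do, which saves extending
\<open>\<phi>\<close> to \<open>K\<close>.\<close>
lemma finitely_generated_with_infinite_abelianization:
  assumes K: "finite_index K" and D: "\<not> finite_index (derived G K)"
    and L: "finite L" "L \<subseteq> K" "generate G L = K"
  shows "\<exists>M (\<phi> :: 'a \<Rightarrow> real) x. finite_index M \<and> x \<in> M \<and> \<phi> x \<noteq> 0 \<and>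
    (\<forall>g\<in>M. \<forall>h\<in>M. \<phi> (g \<otimes> h) = \<phi> g + \<phi> h)"
proof -
  have sub: "subgroup K G" using K by (simp add: finite_index_def)
  have KG: "K \<subseteq> carrier G" by (rule subgroup.subset[OF sub])
  let ?D = "derived G K"
  have DK: "?D \<subseteq> K" by (rule derived_incl[OF subset_refl sub])
  have DG: "subgroup ?D G" by (rule derived_is_subgroup[OF KG])
  have gen: "subgroup (generate G (?D \<union> F)) G" if "F \<subseteq> L" for F
    using that L DK KG by (intro generate_is_subgroup) auto
  have "\<exists>F x. insert x F \<subseteq> L \<and> \<not> finite_index (generate G (?D \<union> F)) \<and> finite_index (generate G (?D \<union> insert x F))"
  proof (rule ccontr)
    assume *: "\<not> ?thesis"
    have "F \<subseteq> L \<Longrightarrow> \<not> finite_index (generate G (?D \<union> F))" if "finite F" for F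
      using that
    proof (induction rule: finite_induct)
      case empty
      have "generate G ?D \<subseteq> ?D" by (rule generate_subgroup_incl[OF subset_refl DG])
      moreover have "?D \<subseteq> generate G ?D" by (auto intro: generate.incl)
      ultimately show ?case using D by simp
    next
      case (insert x F) then show ?case using * by blast
    qed
    then have "\<not> finite_index (generate G (?D \<union> L))" using L(1) by blast
    moreover have "K \<subseteq> generate G (?D \<union> L)"
      unfolding L(3)[symmetric] by (rule mono_generate) blast
    ultimately show False using finite_index_mono[OF K gen[OF subset_refl]] by blast
  qed
  then obtain F x where F: "insert x F \<subseteq> L" "\<not> finite_index (generate G (?D \<union> F))"
    "finite_index (generate G (?D \<union> insert x F))" by blast
  define N where "N = generate G (?D \<union> F)"
  have N: "subgroup N G" unfolding N_def by (rule gen) (use F in auto)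
  have NK: "N \<subseteq> K" unfolding N_def using F(1) L(2) DK by (intro generate_subgroup_incl[OF _ sub]) auto
  have xK: "x \<in> K" using F L by auto
  have xG: "x \<in> carrier G" using xK KG by auto
  have DN: "?D \<subseteq> N" unfolding N_def by (auto intro: generate.incl)
  have normal: "k \<otimes> n \<otimes> inv k \<in> N" if "k \<in> K" "n \<in> N" for k n
  proof -
    have nK: "n \<in> K" using that NK by auto
    have "k \<otimes> n \<otimes> inv k \<otimes> inv n \<in> derived_set G K" using that(1) nK by auto
    then have "k \<otimes> n \<otimes> inv k \<otimes> inv n \<in> N" using DN unfolding derived_def by (auto intro: generate.incl)
    then have "(k \<otimes> n \<otimes> inv k \<otimes> inv n) \<otimes> n \<in> N" using that(2) subgroup.m_closed[OF N] by blast
    moreover have "(k \<otimes> n \<otimes> inv k \<otimes> inv n) \<otimes> n = k \<otimes> n \<otimes> inv k"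
      using that(1) nK KG by (auto simp: m_assoc subset_iff)
    ultimately show ?thesis by simp
  qed
  have M: "generate G (insert x N) = generate G (?D \<union> insert x F)" (is "?A = ?B")
  proof (rule antisym)
    have "?D \<union> insert x F \<subseteq> carrier G" using F(1) L(2) DK KG by auto
    then have B: "subgroup ?B G" by (rule generate_is_subgroup)
    have "N \<subseteq> ?B" unfolding N_def by (rule mono_generate) auto
    then show "?A \<subseteq> ?B" by (intro generate_subgroup_incl[OF _ B]) (auto intro: generate.incl)
    have "insert x N \<subseteq> carrier G" using xG NK KG by auto
    then have A: "subgroup ?A G" by (rule generate_is_subgroup)
    have "F \<subseteq> N" unfolding N_def by (auto intro: generate.incl)
    then have "?D \<union> insert x F \<subseteq> ?A" using DN by (auto intro: generate.incl)
    then show "?B \<subseteq> ?A" by (rule generate_subgroup_incl[OF _ A])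
  qed
  have "x [^] i \<otimes> n \<otimes> x [^] (- i) \<in> N" if "n \<in> N" for n and i :: int
    using normal[OF subgroup_int_pow_closed[OF sub xK, of i] that] xG by (simp add: int_pow_neg)
  from cyclic_extension_additive[OF N xG this] F(2,3) obtain \<phi> :: "'a \<Rightarrow> real"
    where "\<forall>g\<in>generate G (insert x N). \<forall>h\<in>generate G (insert x N). \<phi> (g \<otimes> h) = \<phi> g + \<phi> h" "\<phi> x \<noteq> 0"
    unfolding M N_def[symmetric] by blast
  then show ?thesis using F(3) unfolding M[symmetric]
    by (intro exI[of _ "generate G (insert x N)"] exI[of _ \<phi>] exI[of _ x]) (auto intro: generate.incl)
qed

text \<open>The derived series of the soluble subgroup starts with finite index in \<open>G\<close> and ends with the trivial group, which has
infinite index.\<close>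
lemma virtually_soluble_infinite_abelianization:
  assumes inf: "infinite (carrier G)" and "virtually_soluble G"
  shows "\<exists>K. finite_index K \<and> \<not> finite_index (derived G K)"
proof -
  obtain H where H: "finite_index_subgroup H G" and solv: "solvable (G\<lparr>carrier := H\<rparr>)"
    using assms(2) by (auto simp: virtually_soluble_def)
  have sub: "subgroup H G" using H by (simp add: finite_index_subgroup_def)
  interpret H: group "G\<lparr>carrier := H\<rparr>" by (rule subgroup_imp_group[OF sub])
  obtain n where n: "(derived (G\<lparr>carrier := H\<rparr>) ^^ n) H = {\<one>}"
    using solv unfolding H.solvable_iff_trivial_derived_seq by auto
  have "(derived (G\<lparr>carrier := H\<rparr>) ^^ i) H = (derived G ^^ i) H \<and> (derived G ^^ i) H \<subseteq> H" for i
  proof (induction i)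
    case (Suc i)
    then show ?case using derived_consistent[OF _ sub] derived_incl[OF _ sub] by simp
  qed simp
  then have n: "(derived G ^^ n) H = {\<one>}" using n by simp
  have "\<exists>i. finite_index ((derived G ^^ i) H) \<and> \<not> finite_index (derived G ((derived G ^^ i) H))"
  proof (rule ccontr)
    assume *: "\<not> ?thesis"
    have "finite_index ((derived G ^^ i) H)" for i
      by (induction i) (use finite_index_if_finite_index_subgroup[OF H] * in auto)
    then have "finite_index {\<one>}" using n by metis
    then show False using finite_index_infinite inf by blast
  qed
  then show ?thesis by blast
qed

lemma eval_word_Nil: "eval_word G [] = \<one>"
  and eval_word_Cons: "eval_word G ((s, b) # w) = (if b then s else inv s) \<otimes> eval_word G w"
  by (simp_all add: eval_word_def)

lemma eval_word_closed: "S \<subseteq> carrier G \<Longrightarrow> w \<in> lists (S \<times> UNIV) \<Longrightarrow> eval_word G w \<in> carrier G"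
  by (induction w) (auto simp: eval_word_Nil eval_word_Cons)

lemma eval_word_append:
  assumes "S \<subseteq> carrier G" "v \<in> lists (S \<times> UNIV)" "w \<in> lists (S \<times> UNIV)"
  shows "eval_word G (v @ w) = eval_word G v \<otimes> eval_word G w"
  using assms(2)
proof (induction v)
  case Nil then show ?case using eval_word_closed[OF assms(1,3)] by (simp add: eval_word_Nil)
next
  case (Cons p v)
  obtain s b where p: "p = (s, b)" by fastforce
  have "s \<in> carrier G" using Cons p assms(1) by auto
  then show ?case using Cons eval_word_closed[OF assms(1)] assms(3)
    by (simp add: p eval_word_Cons m_assoc)
qed

definition exponent_sum :: "'a \<Rightarrow> ('a \<times> bool) list \<Rightarrow> real" where
  "exponent_sum x w = (\<Sum>(s, b)\<leftarrow>w. if s = x then (if b then 1 else - 1) else 0)"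

text \<open>Cancelling \<open>s\<close> against its inverse changes neither the value of a word nor its exponent sums.\<close>
lemma free_reduction:
  assumes S: "S \<subseteq> carrier G" and w: "w \<in> lists (S \<times> UNIV)"
  shows "\<exists>r\<in>reduced_words S. eval_word G r = eval_word G w \<and> exponent_sum x r = exponent_sum x w"
  using w
proof (induction w)
  case Nil
  then show ?case by (intro bexI[of _ "[]"]) (auto simp: reduced_words_def)
next
  case (Cons p w)
  obtain s b where p: "p = (s, b)" by fastforce
  have s: "s \<in> S" "s \<in> carrier G" using Cons p S by auto
  obtain r where r: "r \<in> reduced_words S" "eval_word G r = eval_word G w" "exponent_sum x r = exponent_sum x w"
    using Cons by auto
  have rl: "r \<in> lists (S \<times> UNIV)" using r by (simp add: reduced_words_def)
  show ?case
  proof (cases "\<exists>r'. r = (s, \<not> b) # r'")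
    case True
    then obtain r' where r': "r = (s, \<not> b) # r'" by blast
    have r'l: "r' \<in> lists (S \<times> UNIV)" using rl r' by simp
    have "r' \<in> reduced_words S" using r(1) r' by (auto simp: reduced_words_def successively_Cons)
    moreover have "eval_word G (p # w) = eval_word G r'"
    proof -
      have e: "eval_word G r' \<in> carrier G" by (rule eval_word_closed[OF S r'l])
      have "eval_word G (p # w) = (if b then s else inv s) \<otimes> ((if b then inv s else s) \<otimes> eval_word G r')"
        unfolding p eval_word_Cons r(2)[symmetric] r' by (cases b) auto
      then show ?thesis using s e by (cases b) (auto simp: m_assoc[symmetric])
    qed
    moreover have "exponent_sum x (p # w) = exponent_sum x r'"
    proof -
      have "exponent_sum x (p # w) = exponent_sum x [p] + exponent_sum x r" by (simp add: exponent_sum_def r(3)[unfolded exponent_sum_def])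
      then show ?thesis by (auto simp: r' p exponent_sum_def)
    qed
    ultimately show ?thesis by (intro bexI[of _ r']) auto
  next
    case False
    have "p # r \<in> reduced_words S"
    proof (cases r)
      case Nil then show ?thesis using s p by (auto simp: reduced_words_def)
    next
      case (Cons q r')
      obtain t c where q: "q = (t, c)" by fastforce
      then show ?thesis using Cons False r(1) s p by (auto simp: reduced_words_def)
    qed
    then show ?thesis using r(2,3)
      by (intro bexI[of _ "p # r"]) (auto simp: p eval_word_Cons exponent_sum_def)
  qed
qed

text \<open>The exponent sum of one letter in the reduced word of an element. It is additive because it can be computed from any
word representing the element, by reduction, and words can be concatenated.\<close>
lemma free_group_additive:
  assumes "free_group G" "infinite (carrier G)"
  shows "\<exists>(\<phi> :: 'a \<Rightarrow> real) x. x \<in> carrier G \<and> \<phi> x \<noteq> 0 \<and>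
    (\<forall>g\<in>carrier G. \<forall>h\<in>carrier G. \<phi> (g \<otimes> h) = \<phi> g + \<phi> h)"
proof -
  obtain S where S: "S \<subseteq> carrier G" and bij: "bij_betw (eval_word G) (reduced_words S) (carrier G)"
    using assms(1) by (auto simp: free_group_def)
  have "S \<noteq> {}"
  proof
    assume "S = {}"
    then have "reduced_words S \<subseteq> {[]}" by (auto simp: reduced_words_def)
    then have "finite (reduced_words S)" by (rule finite_subset) simp
    then show False using bij_betw_finite[OF bij] assms(2) by simp
  qed
  then obtain x where x: "x \<in> S" by blast
  define \<phi> where "\<phi> g = exponent_sum x (inv_into (reduced_words S) (eval_word G) g)" for g
  have inj: "inj_on (eval_word G) (reduced_words S)" using bij by (simp add: bij_betw_def)
  have \<phi>: "\<phi> (eval_word G w) = exponent_sum x w" if w: "w \<in> lists (S \<times> UNIV)" for w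
  proof -
    obtain r where r: "r \<in> reduced_words S" "eval_word G r = eval_word G w" "exponent_sum x r = exponent_sum x w"
      using free_reduction[OF S w] by blast
    then show ?thesis unfolding \<phi>_def by (metis inv_into_f_f[OF inj r(1)])
  qed
  have "\<phi> (g \<otimes> h) = \<phi> g + \<phi> h" if gh: "g \<in> carrier G" "h \<in> carrier G" for g h
  proof -
    have "g \<in> eval_word G ` reduced_words S" "h \<in> eval_word G ` reduced_words S"
      using gh bij by (auto simp: bij_betw_def)
    then obtain v w where v: "v \<in> lists (S \<times> UNIV)" "g = eval_word G v"
      and w: "w \<in> lists (S \<times> UNIV)" "h = eval_word G w"
      by (auto simp: reduced_words_def)
    have "\<phi> (g \<otimes> h) = \<phi> (eval_word G (v @ w))" using eval_word_append[OF S v(1) w(1)] v w by simp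
    also have "\<dots> = exponent_sum x (v @ w)" using v(1) w(1) by (intro \<phi>) simp
    also have "\<dots> = \<phi> g + \<phi> h" unfolding v(2) w(2) \<phi>[OF v(1)] \<phi>[OF w(1)] by (simp add: exponent_sum_def)
    finally show ?thesis .
  qed
  moreover have "\<phi> x = 1"
  proof -
    have "\<phi> (eval_word G [(x, True)]) = exponent_sum x [(x, True)]" using x by (intro \<phi>) simp
    then show ?thesis using x S by (auto simp: eval_word_Cons eval_word_Nil exponent_sum_def subset_iff)
  qed
  ultimately show ?thesis using x S by (intro exI[of _ \<phi>] exI[of _ x]) auto
qed

end

section \<open>Maximal left ideals that are not finitely generated\<close>

context beurling begin

lemma finite_codimensional_not_finitely_generated:
  assumes inf: "infinite (carrier G)" and "virtually_soluble G \<or> virtually_free G"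
  shows "\<exists>I. left_ideal I A \<and> finite_codimension I A \<and> \<not> finitely_generated_left_ideal I A"
  using assms(2)
proof
  assume "virtually_soluble G"
  then obtain K where K: "finite_index K" "\<not> finite_index (derived G K)"
    using virtually_soluble_infinite_abelianization[OF inf] by blast
  show ?thesis
  proof (cases "\<exists>L. finite L \<and> L \<subseteq> K \<and> generate G L = K")
    case True
    then obtain L where L: "finite L" "L \<subseteq> K" "generate G L = K" by blast
    from finitely_generated_with_infinite_abelianization[OF K L]
    obtain M x and \<phi> :: "'a \<Rightarrow> real" where M: "finite_index M" "x \<in> M" "\<phi> x \<noteq> 0"
      "\<forall>g\<in>M. \<forall>h\<in>M. \<phi> (g \<otimes> h) = \<phi> g + \<phi> h" by blast
    show ?thesis by (rule additive_function_imp_not_finitely_generated[where \<phi> = \<phi>, OF M(1) _ M(2,3)]) (use M(4) in blast)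
  next
    case False
    then show ?thesis by (intro infinitely_generated_imp_not_finitely_generated[OF K(1)]) blast
  qed
next
  assume "virtually_free G"
  then obtain H where H: "finite_index_subgroup H G" "free_group (G\<lparr>carrier := H\<rparr>)"
    by (auto simp: virtually_free_def)
  have fi: "finite_index H" by (rule finite_index_if_finite_index_subgroup[OF H(1)])
  have "infinite H" by (rule finite_index_infinite[OF fi inf])
  interpret H: group "G\<lparr>carrier := H\<rparr>" using H(2) by (simp add: free_group_def)
  obtain \<phi> :: "'a \<Rightarrow> real" and x where \<phi>: "x \<in> H" "\<phi> x \<noteq> 0"
    "\<forall>g\<in>H. \<forall>h\<in>H. \<phi> (g \<otimes> h) = \<phi> g + \<phi> h"
    using H.free_group_additive[OF H(2)] \<open>infinite H\<close> by auto
  show ?thesis by (rule additive_function_imp_not_finitely_generated[where \<phi> = \<phi>, OF fi _ \<phi>(1,2)]) (use \<phi>(3) in blast)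
qed

end

theorem theorem1p2:
  fixes G :: "('a, 'm) monoid_scheme" and \<omega> :: "'a \<Rightarrow> real"
  assumes "group G"
    and "infinite (carrier G)"
    and "virtually_soluble G \<or> virtually_free G"
    and "weight G \<omega>"
  shows "(\<exists>I. maximal_left_ideal I (beurling_algebra G \<omega>) \<and>
              finite_codimension I (beurling_algebra G \<omega>) \<and>
              \<not> finitely_generated_left_ideal I (beurling_algebra G \<omega>)) \<and>
         (\<exists>I. maximal_left_ideal I (beurling_algebra G \<omega>) \<and>
              \<not> finitely_generated_left_ideal I (beurling_algebra G \<omega>))"
proof -
  interpret beurling G \<omega> using assms by (simp add: beurling_def beurling_axioms_def)
  obtain J where J: "left_ideal J A" "finite_codimension J A" "\<not> finitely_generated_left_ideal J A"
    using finite_codimensional_not_finitely_generated[OF assms(2,3)] by blast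
  obtain I where "maximal_left_ideal I A" "finite_codimension I A" "\<not> finitely_generated_left_ideal I A"
    using A.non_finitely_generated_maximal_left_ideal[OF J] by blast
  then show ?thesis by blast
qed


end
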